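(* Let $\mathcal{F}$ and $\mathcal{G}$ be primitive subequations on an open set $X\subset\mathbb{R}^n$ and define $\mathcal{K}=\overline{\mathcal{F}+\mathcal{G}}$. Let $u\in\mathcal{F}(X)$ and $v\in\mathcal{G}(X)$ be (real-valued) locally semiconvex functions on $X$. Then $u+v\in\mathcal{K}(X)$.
   Context: $\mathcal{S}(n)$ is the space of real symmetric $n\times n$ matrices with the Loewner order; $\mathcal{J}^2=\mathbb{R}\times\mathbb{R}^n\times\mathcal{S}(n)$, $\mathcal{J}^2(X)=X\times\mathcal{J}^2$. For $\mathcal{F}\subset\mathcal{J}^2(X)$ the fiber over $x$ is $\mathcal{F}_x=\{(r,p,A)\in\mathcal{J}^2:(x,r,p,A)\in\mathcal{F}\}$. $\mathcal{F}$ is a primitive subequation on $X$ if $\mathcal{F}$ is closed in $\mathcal{J}^2(X)$ and satisfies positivity: $(r,p,A)\in\mathcal{F}_x\Rightarrow(r,p,A+P)\in\mathcal{F}_x$ for all $P>0$ in $\mathcal{S}(n)$ and all $x\in X$. $\mathcal{F}+\mathcal{G}$ is the fiberwise sum, $(\mathcal{F}+\mathcal{G})_x=\mathcal{F}_x+\mathcal{G}_x$ for each $x\in X$, and the closure is taken in $\mathcal{J}^2(X)$. For a subset $\mathcal{F}\subset\mathcal{J}^2(X)$, $\mathcal{F}(X)$ is the set of $\mathcal{F}$-subharmonic functions: upper semicontinuous $u:X\to[-\infty,+\infty)$ such that for every $x\in X$ and every function $\varphi$ which is $C^2$ near $x$ with $u-\varphi\leq0$ near $x$ and $u-\varphi=0$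 at $x$, one has $(\varphi(x),D\varphi(x),D^2\varphi(x))\in\mathcal{F}_x$. A function $u:X\to\mathbb{R}$ is locally semiconvex if every $x\in X$ belongs to some ball $B\subset X$ such that $u+\frac{\lambda}{2}|\cdot|^2$ is convex on $B$ for some $\lambda=\lambda(x)\geq0$. *)

theory Defs
  imports "HOL-Analysis.Analysis"
begin

definition sym_matrices :: "(real^'n^'n) set" where
  "sym_matrices = {A. transpose A = A}"

definition loewner_less :: "real^'n^'n \<Rightarrow> real^'n^'n \<Rightarrow> bool" where
  "loewner_less A B \<longleftrightarrow> (\<forall>\<xi>. \<xi> \<noteq> 0 \<longrightarrow> \<xi> \<bullet> (A *v \<xi>) < \<xi> \<bullet> (B *v \<xi>))"

type_synonym 'n jet = "real \<times> (real^'n) \<times> (real^'n^'n)"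

text \<open>The type of jets does not force the matrix component to be symmetric; this is done by the
  following carrier set.\<close>

definition J2 :: "('n::finite) jet set" where
  "J2 = UNIV \<times> UNIV \<times> sym_matrices"

definition J2_over :: "(real^'n) set \<Rightarrow> ((real^'n) \<times> 'n jet) set" where
  "J2_over X = X \<times> J2"

definition fiber :: "((real^'n) \<times> 'n jet) set \<Rightarrow> real^'n \<Rightarrow> 'n jet set" where
  "fiber F x = {J. (x, J) \<in> F}"

definition primitive_subequation ::
    "(real^'n) set \<Rightarrow> ((real^'n) \<times> 'n jet) set \<Rightarrow> bool" where
  "primitive_subequation X F \<longleftrightarrow>
     closedin (top_of_set (J2_over X)) F \<and>
     (\<forall>x\<in>X. \<forall>r p A. (r, p, A) \<in> fiber F x \<longrightarrow>
        (\<forall>P\<in>sym_matrices. loewner_less 0 P \<longrightarrow> (r, p, A + P) \<in> fiber F x))"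

definition fiberwise_sum ::
    "((real^'n) \<times> 'n jet) set \<Rightarrow> ((real^'n) \<times> 'n jet) set \<Rightarrow> ((real^'n) \<times> 'n jet) set" where
  "fiberwise_sum F G = {(x, J + J') | x J J'. J \<in> fiber F x \<and> J' \<in> fiber G x}"

text \<open>The gradient is the vector of partial derivatives; the \<open>(i, j)\<close> entry of the Hessian is
  \<open>\<partial>\<^sub>j \<partial>\<^sub>i \<phi>\<close>. Both are meaningful only at points of differentiability, which
  the predicate \<open>C2_near\<close> below guarantees.\<close>

definition gradient :: "(real^'n \<Rightarrow> real) \<Rightarrow> real^'n \<Rightarrow> real^'n" where
  "gradient \<phi> x = (\<chi> i. frechet_derivative \<phi> (at x) (axis i 1))"

definition hessian :: "(real^'n \<Rightarrow> real) \<Rightarrow> real^'n \<Rightarrow> real^'n^'n" where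
  "hessian \<phi> x = jacobian (gradient \<phi>) (at x)"

definition C2_near :: "(real^'n \<Rightarrow> real) \<Rightarrow> real^'n \<Rightarrow> bool" where
  "C2_near \<phi> x \<longleftrightarrow>
     (\<exists>U. open U \<and> x \<in> U \<and> \<phi> differentiable_on U \<and> gradient \<phi> differentiable_on U \<and>
          continuous_on U (hessian \<phi>))"

definition usc_on :: "'a::topological_space set \<Rightarrow> ('a \<Rightarrow> ereal) \<Rightarrow> bool" where
  "usc_on X u \<longleftrightarrow> (\<forall>c. openin (top_of_set X) {x \<in> X. u x < c})"

text \<open>Functions on \<open>X\<close> are represented by total functions whose values outside \<open>X\<close> are
  irrelevant.\<close>

definition subharmonics ::
    "((real^'n) \<times> 'n jet) set \<Rightarrow> (real^'n) set \<Rightarrow> (real^'n \<Rightarrow> ereal) set" where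
  "subharmonics F X = {u. (\<forall>x\<in>X. u x \<noteq> \<infinity>) \<and> usc_on X u \<and>
     (\<forall>x\<in>X. \<forall>\<phi>. C2_near \<phi> x \<and>
         (\<forall>\<^sub>F y in nhds x. y \<in> X \<longrightarrow> u y - ereal (\<phi> y) \<le> 0) \<and>
         u x - ereal (\<phi> x) = 0 \<longrightarrow>
       (\<phi> x, gradient \<phi> x, hessian \<phi> x) \<in> fiber F x)}"

definition locally_semiconvex :: "(real^'n) set \<Rightarrow> (real^'n \<Rightarrow> real) \<Rightarrow> bool" where
  "locally_semiconvex X u \<longleftrightarrow>
     (\<forall>x\<in>X. \<exists>c \<rho> \<mu>. x \<in> ball c \<rho> \<and> ball c \<rho> \<subseteq> X \<and> \<mu> \<ge> 0 \<and>
        convex_on (ball c \<rho>) (\<lambda>y. u y + \<mu> / 2 * (norm y)\<^sup>2))"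

end

theory Submission
  imports Defs
begin

text \<open>
  Let \<open>\<phi>\<close> touch \<open>w = u + v\<close> from above at \<open>x0\<close>. The second-order Taylor polynomial of
  \<open>\<phi>\<close> at \<open>x0\<close>, enlarged by a small multiple of \<open>|x - x0|\<^sup>2\<close>, is a quadratic \<open>q\<close>
  such that \<open>w - q\<close> has a strict maximum at \<open>x0\<close>. The difficulty is that \<open>u\<close> and \<open>v\<close> need not
  be twice differentiable at \<open>x0\<close>, so the jet of \<open>\<phi>\<close> does not split there into a jet of \<open>u\<close>
  and a jet of \<open>v\<close>. It does split at suitable points near \<open>x0\<close>, for two reasons.

  Jensen's lemma (\<open>Jensen_contact_set_not_negligible\<close>): the points near \<open>x0\<close> at which
  \<open>w - q\<close>, tilted by some small linear function \<open>p\<close>, attains its maximum do not form a null set.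
  Indeed every small \<open>p\<close> occurs, and by semiconvexity \<open>p\<close> is a Lipschitz function of the
  maximum point, so that a null set of points could not produce a whole ball of slopes.

  Aleksandrov's theorem, restricted to points where the second differences are bounded above
  (\<open>second_order_expansion_off_null_set\<close>): off a null set, \<open>u\<close> and \<open>v\<close> have second-order
  expansions there. At maximum points of the tilted function the bound on second differences is
  automatic: those of \<open>w\<close> are bounded above by those of \<open>q\<close>, and those of \<open>u\<close> and \<open>v\<close> are
  bounded below.

  So near \<open>x0\<close> there is a point \<open>x\<close> where both expansions exist, with
  \<open>Du + Dv = Dq + p\<close> and \<open>D\<^sup>2u + D\<^sup>2v \<le> D\<^sup>2q\<close>. Quadratic test functions put
  \<open>(u, Du, D\<^sup>2u + \<eta>I)\<close> into the fiber of \<open>F\<close> and \<open>(v, Dv, D\<^sup>2v + \<eta>I)\<close> into that of \<open>G\<close>;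
  positivity of \<open>G\<close> then increases the Hessian until the sum of the two is \<open>D\<^sup>2q + 3\<eta>I\<close>
  (\<open>semiconvex_sum_jet\<close>). As \<open>\<eta>\<close>, \<open>p\<close> and \<open>x - x0\<close> tend to zero, these sums converge to
  the jet of \<open>\<phi>\<close> at \<open>x0\<close>, which therefore lies in the closure.

  The Aleksandrov step goes through the proximal map of a convex function \<open>f\<close>, sending \<open>z\<close> to the
  minimiser of \<open>f y + |y - z|\<^sup>2 / 2\<close>. It is 1-Lipschitz, hence differentiable almost everywhere by
  Rademacher's theorem, and it maps the exceptional null set to a null set. The minimal value is a
  function of \<open>z\<close> with gradient \<open>z - prox z\<close>, so it has a second-order expansion wherever the
  proximal map is differentiable; if the derivative of the proximal map is invertible, the
  expansion can be transported to \<open>f\<close>. An upper bound on second differences of \<open>f\<close> is what makes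
  the derivative injective.

  Rademacher's theorem itself rests on the Vitali covering theorem, used in two ways: on lines, to
  see that difference quotients of monotone functions do not oscillate, and in space, to see that a
  closed set is porous at almost none of its points. The latter replaces the usual argument with
  weak derivatives that shows directional derivatives to be linear in the direction.
\<close>

section \<open>Null sets from the Vitali covering theorem\<close>

text \<open>
  Disjoint balls from the cover exhaust \<open>S\<close> up to a null set, and the local estimates add up.
  The measure \<open>\<nu>\<close> is kept apart from Lebesgue measure so that the lemma serves both the Lebesgue
  measure and the Stieltjes measure of a monotone function.
\<close>

lemma emeasure_le_of_Vitali_cover:
  fixes S :: "'a::euclidean_space set"
  assumes S: "S \<in> sets lebesgue" and U: "open U" "S \<subseteq> U" and \<nu>: "sets \<nu> = sets borel"
    and cover: "\<And>x d. x \<in> S \<Longrightarrow> 0 < d \<Longrightarrow> \<exists>a r. 0 < r \<and> r < d \<and> x \<in> cball a r \<and>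
       emeasure lebesgue (S \<inter> cball a r) \<le> c * emeasure \<nu> (cball a r)"
  shows "emeasure lebesgue S \<le> c * emeasure \<nu> U"
proof -
  define K where "K = {(a, r). 0 < r \<and> cball a r \<subseteq> U \<and>
       emeasure lebesgue (S \<inter> cball a r) \<le> c * emeasure \<nu> (cball a r)}"
  have fine: "\<exists>i. i \<in> K \<and> x \<in> cball (fst i) (snd i) \<and> snd i < d" if "x \<in> S" "0 < d" for x d
  proof -
    obtain e where e: "e > 0" "cball x e \<subseteq> U"
      using U \<open>x \<in> S\<close> open_contains_cball by blast
    obtain a r where ar: "0 < r" "r < min d (e/2)" "x \<in> cball a r"
       "emeasure lebesgue (S \<inter> cball a r) \<le> c * emeasure \<nu> (cball a r)"
    proof -
      have "0 < min d (e/2)" using e \<open>0 < d\<close> by simp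
      from cover[OF \<open>x \<in> S\<close> this] obtain a r where "0 < r \<and> r < min d (e/2) \<and> x \<in> cball a r \<and>
        emeasure lebesgue (S \<inter> cball a r) \<le> c * emeasure \<nu> (cball a r)" by (elim exE)
      then show ?thesis using that[of r a] by simp
    qed
    have "cball a r \<subseteq> cball x e"
    proof
      fix y assume "y \<in> cball a r"
      then show "y \<in> cball x e" using ar dist_triangle3[of x y a] by (auto simp: dist_commute)
    qed
    with ar e have "(a, r) \<in> K" by (auto simp: K_def)
    then show ?thesis using ar by force
  qed
  have Kpos: "0 < snd i" if "i \<in> K" for i using that by (auto simp: K_def)
  obtain C where C: "countable C" "C \<subseteq> K"
     "pairwise (\<lambda>i j. disjnt (cball (fst i) (snd i)) (cball (fst j) (snd j))) C"
     and neg: "negligible (S - (\<Union>i\<in>C. cball (fst i) (snd i)))"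
    by (rule Vitali_covering_theorem_cballs[of K snd S fst, OF Kpos fine])
  define B where "B i = cball (fst i :: 'a) (snd i)" for i
  have disj: "disjoint_family_on B C"
    using C(3) by (auto simp: disjoint_family_on_def pairwise_def disjnt_def B_def)
  have B: "B i \<in> sets borel" "B i \<in> sets lebesgue" for i by (auto simp: B_def)
  have "emeasure lebesgue S = emeasure lebesgue (\<Union>i\<in>C. S \<inter> B i)"
  proof -
    have "S = (\<Union>i\<in>C. S \<inter> B i) \<union> (S - (\<Union>i\<in>C. B i))" by auto
    moreover have "S - (\<Union>i\<in>C. B i) \<in> null_sets lebesgue"
      using neg by (simp add: negligible_iff_null_sets B_def)
    moreover have "(\<Union>i\<in>C. S \<inter> B i) \<in> sets lebesgue"
      using C(1) S B by (intro sets.countable_UN'') auto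
    ultimately show ?thesis
      using emeasure_Un_null_set[of "\<Union>i\<in>C. S \<inter> B i" lebesgue "S - (\<Union>i\<in>C. B i)"] by presburger
  qed
  also have "\<dots> = (\<integral>\<^sup>+i. emeasure lebesgue (S \<inter> B i) \<partial>count_space C)"
  proof (rule emeasure_UN_countable)
    show "disjoint_family_on (\<lambda>i. S \<inter> B i) C" using disj unfolding disjoint_family_on_def by blast
  qed (use S B C(1) in auto)
  also have "\<dots> \<le> (\<integral>\<^sup>+i. c * emeasure \<nu> (B i) \<partial>count_space C)"
    using C(2) by (intro nn_integral_mono) (auto simp: K_def B_def)
  also have "\<dots> = c * (\<integral>\<^sup>+i. emeasure \<nu> (B i) \<partial>count_space C)"
    by (intro nn_integral_cmult) auto
  also have "(\<integral>\<^sup>+i. emeasure \<nu> (B i) \<partial>count_space C) = emeasure \<nu> (\<Union>i\<in>C. B i)"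
    using \<nu> B C(1) disj by (subst emeasure_UN_countable) auto
  also have "c * \<dots> \<le> c * emeasure \<nu> U"
  proof (intro mult_left_mono emeasure_mono)
    have "B i \<subseteq> U" if "i \<in> K" for i using that by (auto simp: K_def B_def)
    then show "(\<Union>i\<in>C. B i) \<subseteq> U" using C(2) by blast
    show "U \<in> sets \<nu>" using U \<nu> by auto
  qed auto
  finally show ?thesis .
qed

text \<open>
  A weak form of the Lebesgue density theorem: covering \<open>S\<close> inside an open set that is barely
  larger than \<open>S\<close> gives \<open>|S| \<le> \<theta> |S|\<close>.
\<close>

lemma negligible_of_density_le:
  fixes S :: "'a::euclidean_space set"
  assumes S: "S \<in> sets lebesgue" and \<theta>: "0 \<le> \<theta>" "\<theta> < 1"
    and dens: "\<And>x d. x \<in> S \<Longrightarrow> 0 < d \<Longrightarrow> \<exists>a r. 0 < r \<and> r < d \<and> x \<in> cball a r \<and>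
       emeasure lebesgue (S \<inter> cball a r) \<le> ennreal \<theta> * emeasure lborel (cball a r)"
  shows "negligible S"
proof -
  have "negligible (S \<inter> ball 0 (real N))" for N
  proof -
    define T where "T = S \<inter> ball 0 (real N)"
    have T: "T \<in> sets lebesgue" using S unfolding T_def by (intro sets.Int) auto
    have fin: "emeasure lebesgue T < \<infinity>"
    proof -
      have "emeasure lebesgue T \<le> emeasure lebesgue (ball (0::'a) (real N))"
        by (intro emeasure_mono) (auto simp: T_def)
      also have "\<dots> < \<infinity>" using emeasure_bounded_finite[of "ball (0::'a) (real N)"] by simp
      finally show ?thesis .
    qed
    define m where "m = measure lebesgue T"
    have m: "emeasure lebesgue T = ennreal m" "0 \<le> m"
      using fin by (auto simp: m_def emeasure_eq_ennreal_measure)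
    have "m \<le> \<theta> * (m + \<eta>)" if "\<eta> > 0" for \<eta>
    proof -
      obtain U where U: "open U" "T \<subseteq> U" "(U - T) \<in> lmeasurable" "emeasure lebesgue (U - T) < ennreal \<eta>"
        using sets_lebesgue_outer_open[OF T \<open>\<eta> > 0\<close>] by blast
      have "emeasure lebesgue T \<le> ennreal \<theta> * emeasure lborel U"
      proof (rule emeasure_le_of_Vitali_cover[OF T U(1,2)])
        fix d :: real and y assume "y \<in> T" "0 < d"
        then obtain a r where "0 < r \<and> r < d \<and> y \<in> cball a r \<and>
           emeasure lebesgue (S \<inter> cball a r) \<le> ennreal \<theta> * emeasure lborel (cball a r)"
          using dens[of y d] by (auto simp: T_def)
        moreover have "emeasure lebesgue (T \<inter> cball a r) \<le> emeasure lebesgue (S \<inter> cball a r)"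
          by (intro emeasure_mono) (auto simp: T_def S)
        ultimately show "\<exists>a r. 0 < r \<and> r < d \<and> y \<in> cball a r \<and>
           emeasure lebesgue (T \<inter> cball a r) \<le> ennreal \<theta> * emeasure lborel (cball a r)"
          using order_trans by blast
      qed auto
      also have "emeasure lborel U = emeasure lebesgue (T \<union> (U - T))"
        using U by (simp add: Un_absorb1 )
      also have "\<dots> \<le> emeasure lebesgue T + emeasure lebesgue (U - T)"
        using T U by (intro emeasure_subadditive) auto
      also have "\<dots> \<le> ennreal m + ennreal \<eta>"
        using U m by (intro add_mono) auto
      also have "\<dots> = ennreal (m + \<eta>)" using m that by (simp add: ennreal_plus)
      finally have "ennreal m \<le> ennreal (\<theta> * (m + \<eta>))"
        using m \<theta> that by (simp add: ennreal_mult' mult_left_mono)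
      then show ?thesis using m \<theta> that by simp
    qed
    then have "m \<le> \<theta> * m + \<theta> * \<eta>" if "\<eta> > 0" for \<eta>
      using that by (simp add: algebra_simps)
    moreover have "\<theta> * \<eta> \<le> \<eta>" if "\<eta> > 0" for \<eta> using \<theta> that by (simp add: mult_le_cancel_right1)
    ultimately have "m \<le> \<theta> * m" by (meson add_left_mono field_le_epsilon order_trans)
    then have "m * (1 - \<theta>) \<le> 0" by (simp add: algebra_simps)
    then have "m = 0" using \<theta> m(2) by (auto simp: mult_le_0_iff)
    then show ?thesis using m T by (simp add: negligible_iff_null_sets null_sets_def T_def)
  qed
  then have "negligible (\<Union>N. S \<inter> ball 0 (real N))" by (intro negligible_countable_Union) auto
  moreover have "(\<Union>N. S \<inter> ball 0 (real N)) = S"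
  proof -
    have "\<exists>N. norm x < real N" for x :: 'a using reals_Archimedean2 by blast
    then show ?thesis by auto
  qed
  ultimately show ?thesis by simp
qed

text \<open>
  The set is a \<open>G\<^sub>\<delta>\<close>: a union over \<open>s\<close> of open sets is open, whatever the number of values \<open>s\<close>.
\<close>

lemma borel_frequently_at:
  fixes Q :: "'b::{real_normed_vector} \<Rightarrow> 'a::topological_space \<Rightarrow> bool"
  assumes "\<And>s. s \<noteq> 0 \<Longrightarrow> open {x. Q s x}"
  shows "{x. \<exists>\<^sub>F s in at 0. Q s x} \<in> sets borel"
proof -
  have "{x. \<exists>\<^sub>F s in at 0. Q s x} =
     (\<Inter>n. \<Union>s\<in>{s. s \<noteq> 0 \<and> norm s < inverse (real (Suc n))}. {x. Q s x})"
  proof (safe, goal_cases)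
    case (1 x n)
    then have "\<exists>s. s \<noteq> 0 \<and> norm s < inverse (real (Suc n)) \<and> Q s x"
      unfolding frequently_at by (auto simp del: of_nat_Suc)
    then show ?case by auto
  next
    case (2 x)
    show ?case unfolding frequently_at
    proof safe
      fix d :: real assume "0 < d"
      then obtain n where "inverse (real (Suc n)) < d" using reals_Archimedean by blast
      moreover obtain s where "s \<noteq> 0" "norm s < inverse (real (Suc n))" "Q s x" using 2 by blast
      ultimately show "\<exists>s\<in>UNIV. s \<noteq> 0 \<and> dist s 0 < d \<and> Q s x" by auto
    qed
  qed
  also have "\<dots> \<in> sets borel"
    using assms by (intro sets.countable_INT'' borel_open open_UN ballI) auto
  finally show ?thesis .
qed

text \<open>
  The core of Lebesgue's theorem on monotone functions. Let \<open>\<nu>\<close> be the Stieltjes measure of \<open>g\<close>.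
  Short intervals of slope below \<open>p\<close> have \<open>\<nu>\<close>-measure below \<open>p\<close> times their length. Inside such
  an interval, the part of the exceptional set is covered by intervals of slope above \<open>q\<close>, hence
  has Lebesgue measure at most \<open>1/q\<close> times that \<open>\<nu>\<close>-measure. So the exceptional set has density
  at most \<open>p/q < 1\<close> at arbitrarily small scales.
\<close>

lemma mono_slopes_oscillating_negligible:
  fixes g :: "real \<Rightarrow> real"
  assumes mono: "mono g" and cont: "continuous_on UNIV g" and pq: "p < q"
  shows "negligible {x. (\<exists>\<^sub>F s in at 0. (g (x + s) - g x) / s < p) \<and>
                        (\<exists>\<^sub>F s in at 0. q < (g (x + s) - g x) / s)}" (is "negligible ?E")
proof (cases "0 < p")
  case False
  have "\<not> (\<exists>\<^sub>F s in at 0. (g (x + s) - g x) / s < p)" for x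
  proof -
    have "(g (x + s) - g x) / s \<ge> 0" for s
      using monoD[OF mono, of x "x + s"] monoD[OF mono, of "x + s" x]
      by (cases "s \<ge> 0") (auto simp: divide_nonpos_nonpos)
    then have "\<not> (g (x + s) - g x) / s < p" for s using False by (meson le_less_trans not_less)
    then show ?thesis by (simp add: frequently_def)
  qed
  then show ?thesis by simp
next
  case True
  have E: "?E \<in> sets borel"
  proof -
    have "{x. \<exists>\<^sub>F s in at 0. (g (x + s) - g x) / s < p} \<in> sets borel"
      by (intro borel_frequently_at open_Collect_less continuous_intros continuous_on_compose2[OF cont]) auto
    moreover have "{x. \<exists>\<^sub>F s in at 0. q < (g (x + s) - g x) / s} \<in> sets borel"
      by (intro borel_frequently_at open_Collect_less continuous_intros continuous_on_compose2[OF cont]) auto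
    ultimately show ?thesis unfolding Collect_conj_eq by blast
  qed
  define \<nu> where "\<nu> = interval_measure g"
  have \<nu>: "emeasure \<nu> {a<..b} = ennreal (g b - g a)" if "a \<le> b" for a b
    unfolding \<nu>_def using that mono cont
    by (intro emeasure_interval_measure_Ioc)
      (auto simp: mono_def continuous_on_eq_continuous_within continuous_at_imp_continuous_within)
  have sets_\<nu>: "sets \<nu> = sets borel" by (simp add: \<nu>_def)
  have slope: "\<exists>a b. a < b \<and> x \<in> {a..b} \<and> b - a = \<bar>s\<bar> \<and> (g (x + s) - g x) / s = (g b - g a) / (b - a)"
    if "s \<noteq> 0" for x s
  proof (cases "s > 0")
    case True
    then show ?thesis by (intro exI[of _ x] exI[of _ "x + s"]) auto
  next
    case False
    then have "(g (x + s) - g x) / s = (g x - g (x + s)) / (- s)" by (simp add: divide_simps)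
    then show ?thesis using False that by (intro exI[of _ "x + s"] exI[of _ x]) auto
  qed
  have ball: "cball ((a + b) / 2) ((b - a) / 2) = {a..b}" for a b :: real
    by (auto simp: cball_eq_atLeastAtMost field_simps)
  have intv: "\<exists>c r. 0 < r \<and> r < d \<and> x \<in> cball c r \<and> P (cball c r)"
    if "a < b" "x \<in> {a..b}" "b - a < d" "P {a..b}" for a b x d :: real and P
  proof (rule exI[of _ "(a + b) / 2"], rule exI[of _ "(b - a) / 2"], intro conjI)
    show "x \<in> cball ((a + b) / 2) ((b - a) / 2)" "P (cball ((a + b) / 2) ((b - a) / 2))"
      using that by (simp_all only: ball)
  qed (use that in auto)
  show ?thesis
  proof (rule negligible_of_density_le)
    show "?E \<in> sets lebesgue" using E by auto
    show "0 \<le> p / q" "p / q < 1" using True pq by auto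
    fix x d :: real assume x: "x \<in> ?E" and d: "0 < d"
    then obtain s where s: "s \<noteq> 0" "\<bar>s\<bar> < d" "(g (x + s) - g x) / s < p"
      by (auto simp: frequently_at)
    then obtain a b where ab: "a < b" "x \<in> {a..b}" "b - a = \<bar>s\<bar>" "(g b - g a) / (b - a) < p"
      using slope[of s x] by auto
    define T where "T = ?E \<inter> {a<..<b}"
    have T: "T \<in> sets lebesgue" using E by (auto simp: T_def)
    have "emeasure lebesgue T \<le> ennreal (1 / q) * emeasure \<nu> {a<..<b}"
    proof (rule emeasure_le_of_Vitali_cover[OF T _ _ sets_\<nu>])
      fix y e :: real assume y: "y \<in> T" and e: "0 < e"
      then obtain s where s: "s \<noteq> 0" "\<bar>s\<bar> < e" "q < (g (y + s) - g y) / s"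
        by (auto simp: frequently_at T_def)
      then obtain a' b' where ab': "a' < b'" "y \<in> {a'..b'}" "b' - a' = \<bar>s\<bar>" "q < (g b' - g a') / (b' - a')"
        using slope[of s y] by auto
      have "emeasure lebesgue (T \<inter> {a'..b'}) \<le> emeasure lebesgue {a'..b'}"
        by (intro emeasure_mono) auto
      also have "\<dots> = ennreal (b' - a')" using ab' by simp
      also have "\<dots> \<le> ennreal ((1 / q) * (g b' - g a'))"
        using ab' True pq by (intro ennreal_leI) (simp add: field_simps)
      also have "\<dots> = ennreal (1 / q) * emeasure \<nu> {a'<..b'}"
        using ab' True pq monoD[OF mono, of a' b'] by (subst \<nu>) (auto simp flip: ennreal_mult)
      also have "\<dots> \<le> ennreal (1 / q) * emeasure \<nu> {a'..b'}"
        by (intro mult_left_mono emeasure_mono) (auto simp: sets_\<nu>)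
      finally have *: "emeasure lebesgue (T \<inter> {a'..b'}) \<le> ennreal (1 / q) * emeasure \<nu> {a'..b'}" .
      show "\<exists>a r. 0 < r \<and> r < e \<and> y \<in> cball a r \<and>
         emeasure lebesgue (T \<inter> cball a r) \<le> ennreal (1 / q) * emeasure \<nu> (cball a r)"
        by (rule intv[where P="\<lambda>I. emeasure lebesgue (T \<inter> I) \<le> ennreal (1 / q) * emeasure \<nu> I", OF ab'(1,2) _ *]) (use ab'(3) s(2) in linarith)
    qed (auto simp: T_def)
    also have "\<dots> \<le> ennreal (1 / q) * emeasure \<nu> {a<..b}"
      by (intro mult_left_mono emeasure_mono) (auto simp: sets_\<nu>)
    also have "\<dots> = ennreal (1 / q * (g b - g a))"
      using ab True pq monoD[OF mono, of a b] by (subst \<nu>) (auto simp flip: ennreal_mult)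
    also have "\<dots> \<le> ennreal (p / q * (b - a))"
    proof (intro ennreal_leI)
      have "g b - g a \<le> p * (b - a)" using ab(1,4) by (simp add: pos_divide_less_eq)
      then have "1 / q * (g b - g a) \<le> 1 / q * (p * (b - a))"
        using True pq by (intro mult_left_mono) auto
      then show "1 / q * (g b - g a) \<le> p / q * (b - a)" by simp
    qed
    also have "\<dots> = ennreal (p / q) * emeasure lborel {a..b}"
      using ab True pq by (subst ennreal_mult) auto
    finally have *: "emeasure lebesgue T \<le> ennreal (p / q) * emeasure lborel {a..b}" .
    have "emeasure lebesgue (?E \<inter> {a..b}) = emeasure lebesgue (T \<union> (?E \<inter> {a, b}))"
      using ab by (intro arg_cong[where f="emeasure lebesgue"]) (auto simp: T_def)
    also have "\<dots> = emeasure lebesgue T"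
    proof (rule emeasure_Un_null_set[OF T])
      have "negligible (?E \<inter> {a, b})" by (rule negligible_subset[of "{a,b}"]) auto
      then show "?E \<inter> {a, b} \<in> null_sets lebesgue" by (simp add: negligible_iff_null_sets)
    qed
    finally have eq: "emeasure lebesgue (?E \<inter> {a..b}) = emeasure lebesgue T" .
    have **: "emeasure lebesgue (?E \<inter> {a..b}) \<le> ennreal (p / q) * emeasure lborel {a..b}"
      unfolding eq by (rule *)
    show "\<exists>a r. 0 < r \<and> r < d \<and> x \<in> cball a r \<and>
       emeasure lebesgue (?E \<inter> cball a r) \<le> ennreal (p / q) * emeasure lborel (cball a r)"
      by (rule intv[where P="\<lambda>I. emeasure lebesgue (?E \<inter> I) \<le> ennreal (p / q) * emeasure lborel I", OF ab(1,2) _ **]) (use ab(3) s(2) in linarith)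
  qed
qed

section \<open>Partial derivatives of Lipschitz functions\<close>

text \<open>
  The limit is the infimum of the levels below which \<open>\<phi>\<close> drops arbitrarily close to zero.
\<close>

lemma convergent_at_0_if_not_oscillating:
  fixes \<phi> :: "real \<Rightarrow> real"
  assumes bdd: "\<And>s. \<bar>\<phi> s\<bar> \<le> L"
    and osc: "\<And>p q. p \<in> \<rat> \<Longrightarrow> q \<in> \<rat> \<Longrightarrow> p < q \<Longrightarrow>
      \<not> ((\<exists>\<^sub>F s in at 0. \<phi> s < p) \<and> (\<exists>\<^sub>F s in at 0. q < \<phi> s))"
  shows "\<exists>l. (\<phi> \<longlongrightarrow> l) (at 0)"
proof -
  define A where "A = {p. \<exists>\<^sub>F s in at 0. \<phi> s < p}"
  define l where "l = Inf A"
  have A1: "L + 1 \<in> A"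
  proof -
    have "\<phi> s < L + 1" for s using bdd[of s] by linarith
    then show ?thesis by (simp add: A_def frequently_def)
  qed
  have A2: "- L \<le> p" if "p \<in> A" for p
  proof (rule ccontr)
    assume "\<not> - L \<le> p"
    then have "\<not> \<phi> s < p" for s using bdd[of s] by (auto simp: not_less)
    then show False using that by (simp add: A_def frequently_def)
  qed
  have bb: "bdd_below A" using A2 by (auto simp: bdd_below_def)
  have "(\<phi> \<longlongrightarrow> l) (at 0)"
  proof (rule order_tendstoI)
    fix a assume "a < l"
    obtain a' where a': "a < a'" "a' < l" using dense \<open>a < l\<close> by blast
    then have "a' \<notin> A" using cInf_lower[OF _ bb] unfolding l_def by (meson not_less)
    then have "\<forall>\<^sub>F s in at 0. \<not> \<phi> s < a'" by (simp add: A_def not_frequently)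
    then show "\<forall>\<^sub>F s in at 0. a < \<phi> s" by eventually_elim (use a' in auto)
  next
    fix a assume a: "l < a"
    obtain p where p: "p \<in> \<rat>" "l < p" "p < a" using Rats_dense_in_real[OF a] by auto
    obtain q where q: "q \<in> \<rat>" "p < q" "q < a" using Rats_dense_in_real[OF p(3)] by auto
    obtain p0 where p0: "p0 \<in> A" "p0 < p" using p(2) cInf_lessD[of A p] A1 unfolding l_def by auto
    have "\<exists>\<^sub>F s in at 0. \<phi> s < p"
      using p0 unfolding A_def by (auto elim!: frequently_elim1)
    then have "\<not> (\<exists>\<^sub>F s in at 0. q < \<phi> s)" using osc p q by blast
    then have "\<forall>\<^sub>F s in at 0. \<phi> s \<le> q" by (simp add: not_frequently not_less)
    then show "\<forall>\<^sub>F s in at 0. \<phi> s < a" by eventually_elim (use q in auto)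
  qed
  then show ?thesis by blast
qed

text \<open>
  Adding \<open>L x\<close> makes an \<open>L\<close>-Lipschitz function monotone and shifts all slopes by \<open>L\<close>.
\<close>

lemma Lipschitz_slopes_oscillating_negligible_real:
  fixes g :: "real \<Rightarrow> real"
  assumes lip: "\<And>x y. \<bar>g x - g y\<bar> \<le> L * \<bar>x - y\<bar>" and pq: "p < q"
  shows "negligible {x. (\<exists>\<^sub>F s in at 0. (g (x + s) - g x) / s < p) \<and>
                        (\<exists>\<^sub>F s in at 0. q < (g (x + s) - g x) / s)}"
proof -
  define G where "G x = g x + L * x" for x
  have L: "0 \<le> L" using lip[of 1 0] by simp
  have "mono G"
  proof (rule monoI)
    fix x y :: real assume "x \<le> y"
    then show "G x \<le> G y" using lip[of x y] by (simp add: G_def algebra_simps)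
  qed
  moreover have "continuous_on UNIV g"
    using lip L by (intro continuous_on_iff[THEN iffD2]) (metis (no_types, lifting) dist_real_def lipschitz_on_def lipschitz_on_continuous_on UNIV_I continuous_on_iff)
  then have "continuous_on UNIV G" unfolding G_def by (intro continuous_intros)
  ultimately have "negligible {x. (\<exists>\<^sub>F s in at 0. (G (x + s) - G x) / s < p + L) \<and>
                        (\<exists>\<^sub>F s in at 0. q + L < (G (x + s) - G x) / s)}"
    by (rule mono_slopes_oscillating_negligible) (use pq in simp)
  moreover have "(\<exists>\<^sub>F s in at 0. (G (x + s) - G x) / s < p + L) \<longleftrightarrow> (\<exists>\<^sub>F s in at 0. (g (x + s) - g x) / s < p)"
    "(\<exists>\<^sub>F s in at 0. q + L < (G (x + s) - G x) / s) \<longleftrightarrow> (\<exists>\<^sub>F s in at 0. q < (g (x + s) - g x) / s)" for x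
  proof -
    have "(G (x + s) - G x) / s = (g (x + s) - g x) / s + L" if "s \<noteq> 0" for s
      using that by (simp add: G_def field_simps)
    then have ev: "\<forall>\<^sub>F s in at 0. (G (x + s) - G x) / s = (g (x + s) - g x) / s + L"
      by (auto simp: eventually_at_filter)
    show "(\<exists>\<^sub>F s in at 0. (G (x + s) - G x) / s < p + L) \<longleftrightarrow> (\<exists>\<^sub>F s in at 0. (g (x + s) - g x) / s < p)"
      by (rule frequently_cong[OF ev]) auto
    show "(\<exists>\<^sub>F s in at 0. q + L < (G (x + s) - G x) / s) \<longleftrightarrow> (\<exists>\<^sub>F s in at 0. q < (g (x + s) - g x) / s)"
      by (rule frequently_cong[OF ev]) auto
  qed
  ultimately show ?thesis by simp
qed

text \<open>
  Fubini in the direction \<open>b\<close> without splitting off a coordinate: integrate the indicator of \<open>N\<close> at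
  \<open>x + t b\<close> over all \<open>x\<close> and over \<open>0 \<le> t \<le> 1\<close>. Integrating over \<open>t\<close> first gives zero,
  integrating over \<open>x\<close> first gives the measure of \<open>N\<close> by translation invariance.
\<close>

lemma negligible_of_negligible_line_sections:
  fixes N :: "'a::euclidean_space set"
  assumes N: "N \<in> sets borel" and sec: "\<And>x. negligible {t::real. x + t *\<^sub>R b \<in> N}"
  shows "negligible N"
proof -
  have [measurable]: "N \<in> sets borel" by (rule N)
  have "(\<integral>\<^sup>+t. \<integral>\<^sup>+x. indicator {0..1} t * indicator N (x + t *\<^sub>R b) \<partial>lborel \<partial>lborel)
      = (\<integral>\<^sup>+x. \<integral>\<^sup>+t. indicator {0..1} t * indicator N (x + t *\<^sub>R b) \<partial>lborel \<partial>lborel)"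
    by (rule lborel_pair.Fubini') measurable
  also have "\<dots> = (\<integral>\<^sup>+(x::'a). 0 \<partial>lborel)"
  proof (rule nn_integral_cong)
    fix x :: 'a
    have "{t. x + t *\<^sub>R b \<in> N} \<in> null_sets lborel"
    proof -
      have "(\<lambda>t::real. x + t *\<^sub>R b) \<in> borel_measurable borel" by measurable
      then have "{t. x + t *\<^sub>R b \<in> N} \<in> sets borel"
        using N measurable_sets[of "\<lambda>t::real. x + t *\<^sub>R b" borel borel N] by (simp add: vimage_def)
      then show ?thesis using sec[of x]
        by (simp add: negligible_iff_null_sets null_sets_def)
    qed
    then have "AE t in lborel. t \<notin> {t. x + t *\<^sub>R b \<in> N}" by (rule AE_not_in)
    then have "AE t in lborel. indicator {0..1::real} t * indicator N (x + t *\<^sub>R b) = (0::ennreal)"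
      by eventually_elim simp
    then show "(\<integral>\<^sup>+t. indicator {0..1} t * indicator N (x + t *\<^sub>R b) \<partial>lborel) = 0"
      by (subst nn_integral_0_iff_AE) auto
  qed
  finally have 0: "(\<integral>\<^sup>+t. \<integral>\<^sup>+x. indicator {0..1} t * indicator N (x + t *\<^sub>R b) \<partial>lborel \<partial>lborel) = 0"
    by simp
  have "(\<integral>\<^sup>+x. indicator {0..1::real} t * indicator N (x + t *\<^sub>R b) \<partial>lborel) = indicator {0..1} t * emeasure lborel N" for t
  proof -
    have "(\<integral>\<^sup>+x. indicator {0..1::real} t * indicator N (x + t *\<^sub>R b) \<partial>lborel)
      = indicator {0..1::real} t * (\<integral>\<^sup>+x. indicator N (t *\<^sub>R b + x) \<partial>lborel)"
      by (subst nn_integral_cmult) (auto simp: add.commute)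
    also have "(\<integral>\<^sup>+x. indicator N (t *\<^sub>R b + x) \<partial>lborel) = (\<integral>\<^sup>+x. indicator N x \<partial>(distr lborel borel ((+) (t *\<^sub>R b))))"
      by (subst nn_integral_distr) auto
    also have "\<dots> = emeasure lborel N" by (simp add: lborel_distr_plus N)
    finally show ?thesis .
  qed
  with 0 have "(\<integral>\<^sup>+t. emeasure lborel N * indicator {0..1::real} t  \<partial>lborel) = 0"
    by (simp add: mult.commute)
  then have "emeasure lborel N = 0" by (subst (asm) nn_integral_cmult_indicator) auto
  then show ?thesis using N by (simp add: negligible_iff_null_sets null_sets_def)
qed

lemma Lipschitz_const_nonneg:
  fixes f :: "'a::euclidean_space \<Rightarrow> real"
  assumes lip: "\<And>x y. \<bar>f x - f y\<bar> \<le> L * norm (x - y)"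
  shows "0 \<le> L"
proof -
  obtain b :: 'a where "b \<in> Basis" using nonempty_Basis by blast
  then show ?thesis using lip[of b 0] abs_ge_zero[of "f b - f 0"] by simp
qed

lemma Lipschitz_slopes_oscillating_negligible:
  fixes f :: "'a::euclidean_space \<Rightarrow> real"
  assumes lip: "\<And>x y. \<bar>f x - f y\<bar> \<le> L * norm (x - y)" and pq: "p < q"
  shows "negligible {x. (\<exists>\<^sub>F s in at 0. (f (x + s *\<^sub>R b) - f x) / s < p) \<and>
                        (\<exists>\<^sub>F s in at 0. q < (f (x + s *\<^sub>R b) - f x) / s)}" (is "negligible ?E")
proof (rule negligible_of_negligible_line_sections)
  have L: "0 \<le> L" using lip by (rule Lipschitz_const_nonneg)
  have cont: "continuous_on UNIV f"
    using lip L by (intro lipschitz_on_continuous_on[of L]) (auto simp: lipschitz_on_def dist_norm)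
  have "{x. \<exists>\<^sub>F s in at 0. (f (x + s *\<^sub>R b) - f x) / s < p} \<in> sets borel"
    by (intro borel_frequently_at open_Collect_less continuous_intros continuous_on_compose2[OF cont]) auto
  moreover have "{x. \<exists>\<^sub>F s in at 0. q < (f (x + s *\<^sub>R b) - f x) / s} \<in> sets borel"
    by (intro borel_frequently_at open_Collect_less continuous_intros continuous_on_compose2[OF cont]) auto
  ultimately show "?E \<in> sets borel" unfolding Collect_conj_eq by blast
  fix x
  have "\<bar>f (x + s *\<^sub>R b) - f (x + t *\<^sub>R b)\<bar> \<le> (L * norm b) * \<bar>s - t\<bar>" for s t
    using lip[of "x + s *\<^sub>R b" "x + t *\<^sub>R b"] by (simp flip: scaleR_diff_left add: mult_ac)
  from Lipschitz_slopes_oscillating_negligible_real[of "\<lambda>t. f (x + t *\<^sub>R b)", OF this pq]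
  show "negligible {t. x + t *\<^sub>R b \<in> ?E}" by (simp add: algebra_simps)
qed

text \<open>
  At a point of this set there are arbitrarily small \<open>h\<close> for which the ball of radius
  \<open>\<epsilon> |h|\<close> about \<open>x + h\<close> misses \<open>A\<close>, so \<open>A\<close> misses a fixed proportion of the ball of
  radius \<open>|h|\<close> about \<open>x + h\<close>.
\<close>

lemma porous_part_negligible:
  fixes A :: "'a::euclidean_space set"
  assumes A: "closed A" and \<epsilon>: "0 < \<epsilon>"
  shows "negligible {x \<in> A. \<exists>\<^sub>F h in at 0. \<epsilon> * norm h < infdist (x + h) A}" (is "negligible ?P")
proof (rule negligible_of_density_le)
  have "{x. \<exists>\<^sub>F h in at 0. \<epsilon> * norm h < infdist (x + h) A} \<in> sets borel"
    by (intro borel_frequently_at open_Collect_less continuous_intros)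
  moreover have "?P = A \<inter> {x. \<exists>\<^sub>F h in at 0. \<epsilon> * norm h < infdist (x + h) A}" by auto
  ultimately have "?P \<in> sets borel" using A by auto
  then show "?P \<in> sets lebesgue" by auto
  define e where "e = min \<epsilon> 1"
  have e: "0 < e" "e \<le> \<epsilon>" "e \<le> 1" using \<epsilon> by (auto simp: e_def)
  show "0 \<le> 1 - e ^ DIM('a)" "1 - e ^ DIM('a) < 1" using e by (auto simp: power_le_one)
  fix d :: real and y assume y: "y \<in> ?P" and d: "0 < d"
  then obtain h where h: "h \<noteq> 0" "norm h < d" "\<epsilon> * norm h < infdist (y + h) A"
    by (auto simp: frequently_at)
  let ?B = "cball (y + h) (norm h)" and ?B' = "cball (y + h) (e * norm h)"
  have sub: "?P \<inter> ?B \<subseteq> ?B - ?B'"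
  proof -
    have "z \<notin> ?B'" if "z \<in> A" for z
    proof -
      have "e * norm h \<le> \<epsilon> * norm h" using e by (intro mult_right_mono) auto
      also have "\<dots> < dist (y + h) z" using h infdist_le[OF that, of "y + h"] by linarith
      finally show ?thesis by auto
    qed
    then show ?thesis by auto
  qed
  have B': "?B' \<subseteq> ?B" using e h by (intro subset_cball) (auto simp: mult_le_cancel_right1)
  have "emeasure lebesgue (?P \<inter> ?B) \<le> emeasure lebesgue (?B - ?B')"
    using sub by (intro emeasure_mono) auto
  also have "\<dots> = emeasure lborel ?B - emeasure lborel ?B'"
    using B' emeasure_lborel_cball_finite[of "y + h" "e * norm h"] by (subst emeasure_Diff) auto
  also have "\<dots> = ennreal (unit_ball_vol DIM('a) * norm h ^ DIM('a) - unit_ball_vol DIM('a) * (e * norm h) ^ DIM('a))"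
    using e by (simp add: emeasure_cball ennreal_minus)
  also have "\<dots> = ennreal ((1 - e ^ DIM('a)) * (unit_ball_vol DIM('a) * norm h ^ DIM('a)))"
    by (simp add: power_mult_distrib algebra_simps)
  also have "\<dots> = ennreal (1 - e ^ DIM('a)) * emeasure lborel ?B"
    using e by (subst ennreal_mult) (auto simp: emeasure_cball power_le_one)
  finally show "\<exists>a r. 0 < r \<and> r < d \<and> y \<in> cball a r \<and>
     emeasure lebesgue (?P \<inter> cball a r) \<le> ennreal (1 - e ^ DIM('a)) * emeasure lborel (cball a r)"
    using h by (intro exI[of _ "y + h"] exI[of _ "norm h"]) (auto simp: dist_norm)
qed

section \<open>Rademacher's theorem\<close>

text \<open>
  The increment from \<open>x\<close> to \<open>x + h\<close> is split along the coordinate directions. Each corner of the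
  path is replaced by a nearby point of \<open>A\<close>, at a cost controlled by the Lipschitz constant, and at
  points of \<open>A\<close> increments along the axes are almost those of the linear function \<open>a\<close>.
\<close>

lemma increment_bound_of_near_points:
  fixes f :: "'a::euclidean_space \<Rightarrow> real" and L \<epsilon> \<rho> :: real
  assumes lip: "\<And>x y. \<bar>f x - f y\<bar> \<le> L * norm (x - y)"
    and \<epsilon>: "0 \<le> \<epsilon>"
    and A: "\<And>y b s. y \<in> A \<Longrightarrow> b \<in> Basis \<Longrightarrow> \<bar>s\<bar> \<le> \<rho> \<Longrightarrow>
              \<bar>f (y + s *\<^sub>R b) - f y - s * (a \<bullet> b)\<bar> \<le> \<epsilon> * \<bar>s\<bar>"
    and near: "\<And>k. norm k \<le> DIM('a) * norm h \<Longrightarrow> \<exists>y\<in>A. norm (x + k - y) \<le> \<epsilon> * norm h"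
    and h: "norm h \<le> \<rho>"
  shows "\<bar>f (x + h) - f x - a \<bullet> h\<bar> \<le> DIM('a) * ((2 * L + 1) * \<epsilon>) * norm h"
proof -
  have L: "0 \<le> L" using lip by (rule Lipschitz_const_nonneg)
  define H where "H T = (\<Sum>b\<in>T. (h \<bullet> b) *\<^sub>R b)" for T
  have main: "\<bar>f (x + H T) - f x - a \<bullet> H T\<bar> \<le> card T * ((2 * L + 1) * \<epsilon>) * norm h"
    if "T \<subseteq> Basis" for T
  proof -
    have "finite T" using that finite_Basis finite_subset by blast
    then show ?thesis using that
    proof (induction T rule: finite_induct)
      case empty
      then show ?case by (simp add: H_def)
    next
      case (insert c T)
      then have c: "c \<in> Basis" and T: "T \<subseteq> Basis" by auto
      have "norm (H T) \<le> (\<Sum>b\<in>T. norm h)"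
        unfolding H_def using T Basis_le_norm[of _ h] by (intro sum_norm_le) auto
      also have "\<dots> \<le> DIM('a) * norm h"
        using card_mono[OF finite_Basis T] by (simp add: mult_right_mono)
      finally obtain y where y: "y \<in> A" "norm (x + H T - y) \<le> \<epsilon> * norm h"
        using near by blast
      let ?s = "h \<bullet> c"
      have s: "\<bar>?s\<bar> \<le> norm h" using Basis_le_norm[OF c] .
      have HI: "H (insert c T) = H T + ?s *\<^sub>R c"
        using insert by (simp add: H_def add.commute)
      have 1: "\<bar>f (x + H T + ?s *\<^sub>R c) - f (y + ?s *\<^sub>R c)\<bar> \<le> L * (\<epsilon> * norm h)"
        using lip[of "x + H T + ?s *\<^sub>R c" "y + ?s *\<^sub>R c"] mult_left_mono[OF y(2) L] by simp
      have 2: "\<bar>f (x + H T) - f y\<bar> \<le> L * (\<epsilon> * norm h)"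
        using lip[of "x + H T" y] mult_left_mono[OF y(2) L] by simp
      have 3: "\<bar>f (y + ?s *\<^sub>R c) - f y - ?s * (a \<bullet> c)\<bar> \<le> \<epsilon> * norm h"
        using A[OF y(1) c, of ?s] s h mult_left_mono[OF s \<epsilon>] by linarith
      have 4: "\<bar>f (x + H T) - f x - a \<bullet> H T\<bar> \<le> card T * ((2 * L + 1) * \<epsilon>) * norm h"
        using insert T by blast
      have "a \<bullet> H (insert c T) = a \<bullet> H T + ?s * (a \<bullet> c)"
        by (simp add: HI inner_add_right)
      then have "\<bar>f (x + H (insert c T)) - f x - a \<bullet> H (insert c T)\<bar>
         \<le> L * (\<epsilon> * norm h) + L * (\<epsilon> * norm h) + \<epsilon> * norm h + card T * ((2 * L + 1) * \<epsilon>) * norm h"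
        using 1 2 3 4 HI by (simp add: add.assoc)
      also have "\<dots> = card (insert c T) * ((2 * L + 1) * \<epsilon>) * norm h"
        using insert by (simp add: algebra_simps)
      finally show ?case .
    qed
  qed
  have "H Basis = h" by (simp add: H_def euclidean_representation)
  with main[of Basis] show ?thesis by simp
qed

lemma negligible_UN_countable:
  assumes "countable I" "\<And>i. i \<in> I \<Longrightarrow> negligible (X i)"
  shows "negligible (\<Union>i\<in>I. X i)"
  using assms by (intro negligible_countable_Union) auto

text \<open>
  Let \<open>A a m n\<close> be the closed set of points where, up to the error \<open>1/(m+1)\<close> and the scale
  \<open>1/(n+1)\<close>, the function moves along the axes like the linear function \<open>a\<close>, with \<open>a\<close> from a
  countable dense set. A point where all partial derivatives exist belongs to such a set for every
  \<open>m\<close>. If none of these countably many sets is porous there, \<open>increment_bound_of_near_points\<close> makes the partial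
  derivatives into a total derivative.
\<close>

theorem Rademacher_real:
  fixes f :: "'a::euclidean_space \<Rightarrow> real" and L :: real
  assumes lip: "\<And>x y. \<bar>f x - f y\<bar> \<le> L * norm (x - y)"
  shows "negligible {x. \<not> f differentiable (at x)}"
proof -
  have L: "0 \<le> L" using lip by (rule Lipschitz_const_nonneg)
  have cont: "continuous_on UNIV f"
    using lip L by (intro lipschitz_on_continuous_on[of L]) (auto simp: lipschitz_on_def dist_norm)
  obtain D :: "'a set" where D: "countable D" "\<And>X. open X \<Longrightarrow> X \<noteq> {} \<Longrightarrow> \<exists>d\<in>D. d \<in> X"
    using countable_dense_exists by metis
  define E where "E p q b = {x. (\<exists>\<^sub>F s in at 0. (f (x + s *\<^sub>R b) - f x) / s < p) \<and>
                        (\<exists>\<^sub>F s in at 0. q < (f (x + s *\<^sub>R b) - f x) / s)}" for p q b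
  define N0 where "N0 = (\<Union>p\<in>\<rat>. \<Union>q\<in>\<rat>. \<Union>b\<in>Basis. if p < q then E p q b else {})"
  define A where "A a m n = {y. \<forall>b\<in>Basis. \<forall>s. \<bar>s\<bar> \<le> inverse (real (Suc n)) \<longrightarrow>
              \<bar>f (y + s *\<^sub>R b) - f y - s * (a \<bullet> b)\<bar> \<le> inverse (real (Suc m)) * \<bar>s\<bar>}" for a m n
  define P where "P a m n = {x \<in> A a m n. \<exists>\<^sub>F h in at 0. inverse (real (Suc m)) * norm h < infdist (x + h) (A a m n)}" for a m n
  define N1 where "N1 = (\<Union>a\<in>D. \<Union>m. \<Union>n. P a m n)"
  have "negligible N0" unfolding N0_def
  proof (intro negligible_UN_countable countable_rat countable_finite finite_Basis)
    fix p q b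
    show "negligible (if p < q then E p q b else {})"
      using Lipschitz_slopes_oscillating_negligible[OF lip, of p q b] by (simp add: E_def)
  qed
  have clA: "closed (A a m n)" for a m n
  proof -
    have "A a m n = (\<Inter>b\<in>Basis. \<Inter>s\<in>{s. \<bar>s\<bar> \<le> inverse (real (Suc n))}.
       {y. \<bar>f (y + s *\<^sub>R b) - f y - s * (a \<bullet> b)\<bar> \<le> inverse (real (Suc m)) * \<bar>s\<bar>})"
      by (auto simp: A_def)
    also have "closed \<dots>"
      by (intro closed_INT ballI closed_Collect_le continuous_intros continuous_on_compose2[OF cont]) auto
    finally show ?thesis .
  qed
  have "negligible N1" unfolding N1_def P_def
    by (intro negligible_UN_countable D(1) countableI_type porous_part_negligible clA) simp
  have "f differentiable (at x)" if x: "x \<notin> N0" "x \<notin> N1" for x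
  proof -
    have "\<exists>l. ((\<lambda>s. (f (x + s *\<^sub>R b) - f x) / s) \<longlongrightarrow> l) (at 0)" if b: "b \<in> Basis" for b
    proof (rule convergent_at_0_if_not_oscillating[of _ L])
      fix s :: real
      show "\<bar>(f (x + s *\<^sub>R b) - f x) / s\<bar> \<le> L"
        using lip[of "x + s *\<^sub>R b" x] b L by (cases "s = 0") (simp_all add: field_simps)
    next
      fix p q :: real assume "p \<in> \<rat>" "q \<in> \<rat>" "p < q"
      then have "x \<notin> E p q b" using x(1) b by (auto simp: N0_def)
      then show "\<not> ((\<exists>\<^sub>F s in at 0. (f (x + s *\<^sub>R b) - f x) / s < p) \<and>
                        (\<exists>\<^sub>F s in at 0. q < (f (x + s *\<^sub>R b) - f x) / s))" by (simp add: E_def)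
    qed
    then obtain l where l: "\<And>b. b \<in> Basis \<Longrightarrow> ((\<lambda>s. (f (x + s *\<^sub>R b) - f x) / s) \<longlongrightarrow> l b) (at 0)"
      by metis
    define g where "g = (\<Sum>b\<in>Basis. l b *\<^sub>R b)"
    have g: "g \<bullet> b = l b" if "b \<in> Basis" for b using that by (simp add: g_def)
    define K where "K = DIM('a) * ((2 * L + 1) * DIM('a)) + 1"
    have K: "0 < K" using L by (simp add: K_def add_nonneg_pos)
    have approx: "\<exists>d>0. \<forall>h. norm h < d \<longrightarrow> \<bar>f (x + h) - f x - g \<bullet> h\<bar> \<le> e * norm h" if e0: "e > 0" for e
    proof -
      obtain m where m: "inverse (real (Suc m)) < e / K" using reals_Archimedean[of "e / K"] K e0 by (auto simp del: of_nat_Suc)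
      define \<epsilon> where "\<epsilon> = inverse (real (Suc m))"
      have \<epsilon>: "0 < \<epsilon>" "\<epsilon> * K < e" using m K by (simp_all add: \<epsilon>_def pos_less_divide_eq)
      obtain a where a: "a \<in> D" "norm (a - g) < \<epsilon> / 2"
        using D(2)[of "ball g (\<epsilon>/2)"] \<epsilon> by (auto simp: dist_norm norm_minus_commute)
      have "\<exists>d>0. \<forall>s. \<bar>s\<bar> < d \<longrightarrow> \<bar>f (x + s *\<^sub>R b) - f x - s * (a \<bullet> b)\<bar> \<le> \<epsilon> * \<bar>s\<bar>" if b: "b \<in> Basis" for b
      proof -
        have "\<forall>\<^sub>F s in at 0. dist ((f (x + s *\<^sub>R b) - f x) / s) (l b) < \<epsilon> / 2"
          using l[OF b] \<epsilon> by (intro tendstoD) auto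
        then obtain d where d: "d > 0" "\<And>s. s \<noteq> 0 \<Longrightarrow> \<bar>s\<bar> < d \<Longrightarrow> \<bar>(f (x + s *\<^sub>R b) - f x) / s - l b\<bar> < \<epsilon> / 2"
          by (auto simp: eventually_at dist_real_def)
        have ab: "\<bar>l b - a \<bullet> b\<bar> \<le> \<epsilon> / 2"
          using Basis_le_norm[OF b, of "a - g"] a(2) g[OF b] unfolding inner_diff_left by linarith
        have "\<bar>f (x + s *\<^sub>R b) - f x - s * (a \<bullet> b)\<bar> \<le> \<epsilon> * \<bar>s\<bar>" if "\<bar>s\<bar> < d" for s
        proof (cases "s = 0")
          case False
          have "\<bar>(f (x + s *\<^sub>R b) - f x) / s - a \<bullet> b\<bar> \<le> \<epsilon>"
            using d(2)[OF False that] ab by linarith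
          then have "\<bar>s\<bar> * \<bar>(f (x + s *\<^sub>R b) - f x) / s - a \<bullet> b\<bar> \<le> \<bar>s\<bar> * \<epsilon>"
            by (rule mult_left_mono) simp
          moreover have "\<bar>s\<bar> * \<bar>(f (x + s *\<^sub>R b) - f x) / s - a \<bullet> b\<bar> = \<bar>f (x + s *\<^sub>R b) - f x - s * (a \<bullet> b)\<bar>"
          proof -
            have "s * (X / s - c) = X - s * c" for X c using False by (simp add: field_simps)
            then show ?thesis by (simp flip: abs_mult)
          qed
          ultimately show ?thesis by (simp add: mult.commute)
        qed simp
        then show ?thesis using d by blast
      qed
      then obtain d where d: "\<And>b. b \<in> Basis \<Longrightarrow> d b > 0"
        "\<And>b s. b \<in> Basis \<Longrightarrow> \<bar>s\<bar> < d b \<Longrightarrow> \<bar>f (x + s *\<^sub>R b) - f x - s * (a \<bullet> b)\<bar> \<le> \<epsilon> * \<bar>s\<bar>"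
        by metis
      obtain n where n: "inverse (real (Suc n)) < Min (d ` (Basis::'a set))"
        using reals_Archimedean[of "Min (d ` (Basis::'a set))"] d(1) by (auto simp del: of_nat_Suc)
      define \<rho> where "\<rho> = inverse (real (Suc n))"
      have \<rho>: "0 < \<rho>" by (simp add: \<rho>_def)
      have xA: "x \<in> A a m n"
        unfolding A_def \<epsilon>_def[symmetric]
      proof safe
        fix b :: 'a and s :: real assume b: "b \<in> Basis" and s: "\<bar>s\<bar> \<le> inverse (real (Suc n))"
        have "inverse (real (Suc n)) < d b" using n b by (subst (asm) Min_gr_iff) auto
        then show "\<bar>f (x + s *\<^sub>R b) - f x - s * (a \<bullet> b)\<bar> \<le> \<epsilon> * \<bar>s\<bar>"
          using d(2)[OF b] s by (meson order.strict_trans1)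
      qed
      then have "\<not> (\<exists>\<^sub>F h in at 0. \<epsilon> * norm h < infdist (x + h) (A a m n))"
        using x(2) a(1) by (auto simp: N1_def P_def \<epsilon>_def)
      then have "\<forall>\<^sub>F h in at 0. infdist (x + h) (A a m n) \<le> \<epsilon> * norm h"
        by (simp add: not_frequently not_less)
      then obtain r where r: "r > 0" "\<And>h. h \<noteq> 0 \<Longrightarrow> norm h < r \<Longrightarrow> infdist (x + h) (A a m n) \<le> \<epsilon> * norm h"
        by (auto simp: eventually_at)
      have near: "\<exists>y\<in>A a m n. norm (x + k - y) \<le> \<epsilon> * norm k" if "norm k < r" for k
      proof (cases "k = 0")
        case True then show ?thesis using xA by auto
      next
        case False
        obtain y where "y \<in> A a m n" "infdist (x + k) (A a m n) = dist (x + k) y"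
          using infdist_attains_inf[OF clA] xA by blast
        then show ?thesis using r(2)[OF False that] by (auto simp: dist_norm)
      qed
      define d' where "d' = min (r / DIM('a)) \<rho>"
      have "d' > 0" using r \<rho> by (simp add: d'_def)
      moreover have "\<bar>f (x + h) - f x - g \<bullet> h\<bar> \<le> e * norm h" if h: "norm h < d'" for h
      proof -
        define \<epsilon>' where "\<epsilon>' = \<epsilon> * DIM('a)"
        have \<epsilon>': "\<epsilon> \<le> \<epsilon>'" "0 \<le> \<epsilon>'" using \<epsilon> DIM_positive[where 'a='a]
          by (auto simp: \<epsilon>'_def mult_le_cancel_left1 Suc_leI)
        have "\<bar>f (x + h) - f x - a \<bullet> h\<bar> \<le> DIM('a) * ((2 * L + 1) * \<epsilon>') * norm h"
        proof (rule increment_bound_of_near_points[OF lip \<epsilon>'(2), where A = "A a m n" and \<rho> = \<rho>])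
          fix y b s assume "y \<in> A a m n" "b \<in> (Basis :: 'a set)" "\<bar>s\<bar> \<le> \<rho>"
          then have "\<bar>f (y + s *\<^sub>R b) - f y - s * (a \<bullet> b)\<bar> \<le> \<epsilon> * \<bar>s\<bar>"
            by (auto simp: A_def \<epsilon>_def \<rho>_def)
          also have "\<dots> \<le> \<epsilon>' * \<bar>s\<bar>" using \<epsilon>' by (intro mult_right_mono) auto
          finally show "\<bar>f (y + s *\<^sub>R b) - f y - s * (a \<bullet> b)\<bar> \<le> \<epsilon>' * \<bar>s\<bar>" .
        next
          fix k :: 'a assume k: "norm k \<le> DIM('a) * norm h"
          also have "\<dots> < r" using h by (simp add: d'_def pos_less_divide_eq mult.commute)
          finally obtain y where "y \<in> A a m n" "norm (x + k - y) \<le> \<epsilon> * norm k" using near by blast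
          moreover have "\<epsilon> * norm k \<le> \<epsilon>' * norm h"
            using mult_left_mono[OF k, of \<epsilon>] \<epsilon> by (simp add: \<epsilon>'_def mult.assoc)
          ultimately show "\<exists>y\<in>A a m n. norm (x + k - y) \<le> \<epsilon>' * norm h" by force
        qed (use h in \<open>auto simp: d'_def\<close>)
        moreover have "\<bar>a \<bullet> h - g \<bullet> h\<bar> \<le> \<epsilon> * norm h"
        proof -
          have "\<bar>(a - g) \<bullet> h\<bar> \<le> norm (a - g) * norm h" by (rule Cauchy_Schwarz_ineq2)
          also have "\<dots> \<le> \<epsilon> * norm h" using a \<epsilon> by (intro mult_right_mono) auto
          finally show ?thesis by (simp add: inner_diff_left)
        qed
        ultimately have "\<bar>f (x + h) - f x - g \<bullet> h\<bar> \<le> DIM('a) * ((2 * L + 1) * \<epsilon>') * norm h + \<epsilon> * norm h" by linarith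
        also have "\<dots> = \<epsilon> * K * norm h" by (simp add: K_def \<epsilon>'_def algebra_simps)
        also have "\<dots> \<le> e * norm h" using \<epsilon> by (intro mult_right_mono) auto
        finally show ?thesis .
      qed
      ultimately show ?thesis by blast
    qed
    have "(f has_derivative (\<lambda>h. g \<bullet> h)) (at x)"
      unfolding has_derivative_at_alt
    proof (intro conjI allI impI)
      show "bounded_linear ((\<bullet>) g)" by (rule bounded_linear_inner_right)
      fix e :: real assume "0 < e"
      then obtain d where d: "d > 0" "\<And>h. norm h < d \<Longrightarrow> \<bar>f (x + h) - f x - g \<bullet> h\<bar> \<le> e * norm h"
        using approx by blast
      show "\<exists>d>0. \<forall>y. norm (y - x) < d \<longrightarrow> norm (f y - f x - g \<bullet> (y - x)) \<le> e * norm (y - x)"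
        using d(1) d(2)[of "y - x" for y] by (intro exI[of _ d]) auto
    qed
    then show ?thesis by (auto simp: differentiable_def)
  qed
  then have "{x. \<not> f differentiable (at x)} \<subseteq> N0 \<union> N1" by auto
  moreover have "negligible (N0 \<union> N1)"
    using \<open>negligible N0\<close> \<open>negligible N1\<close> by (rule negligible_Un)
  ultimately show ?thesis using negligible_subset by blast
qed

corollary Rademacher:
  fixes f :: "'a::euclidean_space \<Rightarrow> 'b::euclidean_space" and L :: real
  assumes lip: "\<And>x y. norm (f x - f y) \<le> L * norm (x - y)"
  shows "negligible {x. \<not> f differentiable (at x)}"
proof -
  have "negligible {x. \<not> (\<lambda>x. f x \<bullet> b) differentiable (at x)}" if "b \<in> Basis" for b
  proof (rule Rademacher_real[where L = L])
    fix x y show "\<bar>f x \<bullet> b - f y \<bullet> b\<bar> \<le> L * norm (x - y)"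
      using Basis_le_norm[OF that, of "f x - f y"] lip[of x y] by (simp add: inner_diff_left)
  qed
  then have "negligible (\<Union>b\<in>Basis. {x. \<not> (\<lambda>x. f x \<bullet> b) differentiable (at x)})"
    by (intro negligible_Union) auto
  moreover have "{x. \<not> f differentiable (at x)} \<subseteq> (\<Union>b\<in>Basis. {x. \<not> (\<lambda>x. f x \<bullet> b) differentiable (at x)})"
    by (subst differentiable_componentwise_within) auto
  ultimately show ?thesis by (rule negligible_subset)
qed

section \<open>Second-order expansions\<close>

text \<open>
  The Peano form of a second-order Taylor formula, as in Aleksandrov's theorem. Only the quadratic form
  of \<open>A\<close> is determined by \<open>f\<close>.
\<close>

definition second_order_expansion ::
    "('a::euclidean_space \<Rightarrow> real) \<Rightarrow> 'a \<Rightarrow> 'a \<Rightarrow> ('a \<Rightarrow> 'a) \<Rightarrow> bool" where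
  "second_order_expansion f x p A \<longleftrightarrow>
     (\<forall>e>0. \<exists>d>0. \<forall>h. norm h < d \<longrightarrow> \<bar>f (x + h) - f x - p \<bullet> h - A h \<bullet> h / 2\<bar> \<le> e * (norm h)\<^sup>2)"

text \<open>
  Along a segment from \<open>x\<close>, the remainder has derivative
  \<open>(G (x + t h) - G x - A (t h)) \<bullet> h\<close>, which is \<open>o(|h|\<^sup>2)\<close> by differentiability of \<open>G\<close> at \<open>x\<close>.
\<close>

lemma second_order_Taylor:
  fixes f :: "'a::euclidean_space \<Rightarrow> real"
  assumes r: "0 < r" and f: "\<And>y. y \<in> ball x r \<Longrightarrow> (f has_derivative (\<lambda>h. G y \<bullet> h)) (at y)"
    and G: "(G has_derivative A) (at x)"
  shows "second_order_expansion f x (G x) A"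
  unfolding second_order_expansion_def
proof (intro allI impI)
  fix e :: real assume e: "0 < e"
  interpret A: bounded_linear A using G by (rule has_derivative_bounded_linear)
  obtain d where d: "d > 0" "\<And>k. norm k < d \<Longrightarrow> norm (G (x + k) - G x - A k) \<le> e * norm k"
    using G[unfolded has_derivative_at_alt] e by (metis add_diff_cancel_left')
  have "\<bar>f (x + h) - f x - G x \<bullet> h - A h \<bullet> h / 2\<bar> \<le> e * (norm h)\<^sup>2" if h: "norm h < min d r" for h
  proof -
    define \<phi> where "\<phi> t = f (x + t *\<^sub>R h) - t * (G x \<bullet> h) - t\<^sup>2 / 2 * (A h \<bullet> h)" for t
    have th: "norm (t *\<^sub>R h) \<le> norm h" if "0 \<le> t" "t \<le> 1" for t
      using that by (simp add: mult_left_le_one_le)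
    have der: "(\<phi> has_derivative (\<lambda>s. s * ((G (x + t *\<^sub>R h) - G x - A (t *\<^sub>R h)) \<bullet> h))) (at t within {0..1})"
      if "t \<in> {0..1}" for t
    proof -
      have "x + t *\<^sub>R h \<in> ball x r" using th[of t] that h by (auto simp: dist_norm)
      from f[OF this] have "((\<lambda>t. f (x + t *\<^sub>R h)) has_derivative (\<lambda>s. G (x + t *\<^sub>R h) \<bullet> (s *\<^sub>R h))) (at t)"
        by (rule has_derivative_compose[rotated]) (auto intro!: derivative_eq_intros)
      then have "(\<phi> has_derivative (\<lambda>s. s * ((G (x + t *\<^sub>R h) - G x - A (t *\<^sub>R h)) \<bullet> h))) (at t)"
        unfolding \<phi>_def
        by (auto intro!: derivative_eq_intros simp: A.scaleR inner_diff_left algebra_simps)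
      then show ?thesis by (rule has_derivative_at_withinI)
    qed
    have "norm (\<phi> 1 - \<phi> 0) \<le> (e * (norm h)\<^sup>2) * norm (1 - 0 :: real)"
    proof (rule differentiable_bound[OF _ der])
      fix t :: real assume t: "t \<in> {0..1}"
      have "norm ((G (x + t *\<^sub>R h) - G x - A (t *\<^sub>R h)) \<bullet> h) \<le> norm (G (x + t *\<^sub>R h) - G x - A (t *\<^sub>R h)) * norm h"
        using Cauchy_Schwarz_ineq2 by auto
      also have "\<dots> \<le> (e * norm (t *\<^sub>R h)) * norm h"
        using d(2)[of "t *\<^sub>R h"] th[of t] t h by (intro mult_right_mono) auto
      also have "\<dots> \<le> (e * norm h) * norm h"
        using th[of t] t e by (intro mult_right_mono mult_left_mono) auto
      finally have "norm ((G (x + t *\<^sub>R h) - G x - A (t *\<^sub>R h)) \<bullet> h) \<le> e * (norm h)\<^sup>2"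
        by (simp add: power2_eq_square mult.assoc)
      then show "onorm (\<lambda>s. s * ((G (x + t *\<^sub>R h) - G x - A (t *\<^sub>R h)) \<bullet> h)) \<le> e * (norm h)\<^sup>2"
        by (intro onorm_le) (simp add: abs_mult mult.commute mult_left_mono)
    qed auto
    then show ?thesis by (simp add: \<phi>_def algebra_simps)
  qed
  then show "\<exists>d>0. \<forall>h. norm h < d \<longrightarrow> \<bar>f (x + h) - f x - G x \<bullet> h - A h \<bullet> h / 2\<bar> \<le> e * (norm h)\<^sup>2"
    using d r by (intro exI[of _ "min d r"]) auto
qed

text \<open>
  The mixed second difference of \<open>f\<close> at scale \<open>s\<close> is symmetric in \<open>h\<close> and \<open>k\<close>, and the mean
  value theorem identifies its leading term as \<open>s\<^sup>2 (A h \<bullet> k)\<close>.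
\<close>

lemma second_derivative_symmetric:
  fixes f :: "'a::euclidean_space \<Rightarrow> real"
  assumes r: "0 < r" and f: "\<And>y. y \<in> ball x r \<Longrightarrow> (f has_derivative (\<lambda>h. G y \<bullet> h)) (at y)"
    and G: "(G has_derivative A) (at x)"
  shows "A h \<bullet> k = A k \<bullet> h"
proof -
  interpret A: bounded_linear A using G by (rule has_derivative_bounded_linear)
  define \<Delta> where "\<Delta> h k s = f (x + s *\<^sub>R h + s *\<^sub>R k) - f (x + s *\<^sub>R h) - f (x + s *\<^sub>R k) + f x" for h k and s :: real
  have chain: "((\<lambda>t. f (y + t *\<^sub>R k)) has_derivative (\<lambda>u. G (y + t *\<^sub>R k) \<bullet> (u *\<^sub>R k))) (at t)"
    if "y + t *\<^sub>R k \<in> ball x r" for y k t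
    using f[OF that] by (rule has_derivative_compose[rotated]) (auto intro!: derivative_eq_intros)
  define m where "m = norm h + norm k + 1"
  have m: "m > 0" "norm h \<le> m" "norm k \<le> m" by (auto simp: m_def add_nonneg_pos)
  have est: "\<exists>\<delta>>0. \<forall>s. 0 < s \<longrightarrow> s < \<delta> \<longrightarrow> \<bar>\<Delta> h k s - s\<^sup>2 * (A h \<bullet> k)\<bar> \<le> e * s\<^sup>2"
    if e: "e > 0" and hk: "norm h \<le> m" "norm k \<le> m" for e h k
  proof -
    define e' where "e' = e / (3 * m * m)"
    have e': "e' > 0" using e m by (simp add: e'_def)
    obtain d where d: "d > 0" "\<And>k. norm k < d \<Longrightarrow> norm (G (x + k) - G x - A k) \<le> e' * norm k"
      using G[unfolded has_derivative_at_alt] e' by (metis add_diff_cancel_left')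
    define \<delta> where "\<delta> = min d r / (2 * m)"
    have \<delta>: "\<delta> > 0" using d r m by (simp add: \<delta>_def)
    have "\<bar>\<Delta> h k s - s\<^sup>2 * (A h \<bullet> k)\<bar> \<le> e * s\<^sup>2" if s: "0 < s" "s < \<delta>" for s
    proof -
      have sm: "s * m + s * m < min d r" using s m by (simp add: \<delta>_def pos_less_divide_eq algebra_simps)
      have tk: "norm (t *\<^sub>R k) \<le> s * m" if "0 \<le> t" "t \<le> s" for t
        using that hk s by (simp add: mult_mono)
      have sh: "norm (s *\<^sub>R h) \<le> s * m" using s hk by (simp add: mult_mono)
      define \<psi> where "\<psi> t = f (x + s *\<^sub>R h + t *\<^sub>R k) - f (x + t *\<^sub>R k) - t * (s * (A h \<bullet> k))" for t
      have der: "(\<psi> has_derivative (\<lambda>u. u * ((G (x + s *\<^sub>R h + t *\<^sub>R k) - G (x + t *\<^sub>R k) - s *\<^sub>R A h) \<bullet> k))) (at t within {0..s})"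
        if t: "t \<in> {0..s}" for t
      proof -
        have "norm (s *\<^sub>R h + t *\<^sub>R k) < r" "norm (t *\<^sub>R k) < r"
        proof -
          have "norm (t *\<^sub>R k) \<le> s * m" using tk[of t] t by auto
          moreover have "0 \<le> s * m" using s m by simp
          ultimately show "norm (s *\<^sub>R h + t *\<^sub>R k) < r" "norm (t *\<^sub>R k) < r"
            using sh sm norm_triangle_ineq[of "s *\<^sub>R h" "t *\<^sub>R k"] by linarith+
        qed
        moreover have mem_ball_iff: "x + w \<in> ball x r \<longleftrightarrow> norm w < r" for w by (simp add: dist_norm)
        ultimately have "x + s *\<^sub>R h + t *\<^sub>R k \<in> ball x r" "x + t *\<^sub>R k \<in> ball x r"
          by (auto simp: mem_ball_iff add.assoc)
        then have "((\<lambda>t. f (x + s *\<^sub>R h + t *\<^sub>R k)) has_derivative (\<lambda>u. G (x + s *\<^sub>R h + t *\<^sub>R k) \<bullet> (u *\<^sub>R k))) (at t)"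
          "((\<lambda>t. f (x + t *\<^sub>R k)) has_derivative (\<lambda>u. G (x + t *\<^sub>R k) \<bullet> (u *\<^sub>R k))) (at t)"
          using chain f by blast+
        then have "(\<psi> has_derivative (\<lambda>u. u * ((G (x + s *\<^sub>R h + t *\<^sub>R k) - G (x + t *\<^sub>R k) - s *\<^sub>R A h) \<bullet> k))) (at t)"
          unfolding \<psi>_def by (auto intro!: derivative_eq_intros simp: inner_diff_left algebra_simps)
        then show ?thesis by (rule has_derivative_at_withinI)
      qed
      have "norm (\<psi> s - \<psi> 0) \<le> (e * s) * norm (s - 0)"
      proof (rule differentiable_bound[OF _ der])
        fix t :: real assume t: "t \<in> {0..s}"
        let ?a = "G (x + (s *\<^sub>R h + t *\<^sub>R k)) - G x - A (s *\<^sub>R h + t *\<^sub>R k)" and ?b = "G (x + t *\<^sub>R k) - G x - A (t *\<^sub>R k)"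
        have n2: "norm (t *\<^sub>R k) \<le> s * m" using tk[of t] t by auto
        have n1: "norm (s *\<^sub>R h + t *\<^sub>R k) \<le> s * m + s * m"
          using n2 sh norm_triangle_ineq[of "s *\<^sub>R h" "t *\<^sub>R k"] by linarith
        have sm0: "0 \<le> s * m" using s m by simp
        have "norm ?a \<le> e' * (s * m + s * m)"
          using d(2)[of "s *\<^sub>R h + t *\<^sub>R k"] n1 sm mult_left_mono[OF n1, of e'] e' by linarith
        moreover have "norm ?b \<le> e' * (s * m)"
          using d(2)[of "t *\<^sub>R k"] n2 sm sm0 mult_left_mono[OF n2, of e'] e' by linarith
        ultimately have ab: "norm (?a - ?b) \<le> 3 * e' * s * m"
          using norm_triangle_ineq4[of ?a ?b] by (simp add: algebra_simps)
        have "G (x + s *\<^sub>R h + t *\<^sub>R k) - G (x + t *\<^sub>R k) - s *\<^sub>R A h = ?a - ?b"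
          by (simp add: A.add A.scaleR algebra_simps)
        then have "norm ((G (x + s *\<^sub>R h + t *\<^sub>R k) - G (x + t *\<^sub>R k) - s *\<^sub>R A h) \<bullet> k) \<le> norm (?a - ?b) * norm k"
          unfolding real_norm_def by (simp only: Cauchy_Schwarz_ineq2)
        also have "\<dots> \<le> (3 * e' * s * m) * m"
          using ab hk m e' s by (intro mult_mono) auto
        also have "\<dots> = e * s" using m by (simp add: e'_def)
        finally show "onorm (\<lambda>u. u * ((G (x + s *\<^sub>R h + t *\<^sub>R k) - G (x + t *\<^sub>R k) - s *\<^sub>R A h) \<bullet> k)) \<le> e * s"
          by (intro onorm_le) (simp add: abs_mult mult.commute mult_left_mono)
      qed (use s in auto)
      then show ?thesis using s by (simp add: \<psi>_def \<Delta>_def power2_eq_square algebra_simps)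
    qed
    then show ?thesis using \<delta> by blast
  qed
  have "\<bar>A h \<bullet> k - A k \<bullet> h\<bar> \<le> 2 * e" if e: "e > 0" for e
  proof -
    obtain \<delta>1 where 1: "\<delta>1 > 0" "\<And>s. 0 < s \<Longrightarrow> s < \<delta>1 \<Longrightarrow> \<bar>\<Delta> h k s - s\<^sup>2 * (A h \<bullet> k)\<bar> \<le> e * s\<^sup>2"
      using est[OF e m(2,3)] by blast
    obtain \<delta>2 where 2: "\<delta>2 > 0" "\<And>s. 0 < s \<Longrightarrow> s < \<delta>2 \<Longrightarrow> \<bar>\<Delta> k h s - s\<^sup>2 * (A k \<bullet> h)\<bar> \<le> e * s\<^sup>2"
      using est[OF e m(3,2)] by blast
    obtain s where s: "0 < s" "s < min \<delta>1 \<delta>2" using dense[of 0 "min \<delta>1 \<delta>2"] 1 2 by auto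
    have "\<Delta> k h s = \<Delta> h k s" by (simp add: \<Delta>_def algebra_simps)
    then have "\<bar>s\<^sup>2 * (A h \<bullet> k) - s\<^sup>2 * (A k \<bullet> h)\<bar> \<le> e * s\<^sup>2 + e * s\<^sup>2"
      using 1(2)[of s] 2(2)[of s] s by auto
    then have "s\<^sup>2 * \<bar>A h \<bullet> k - A k \<bullet> h\<bar> \<le> s\<^sup>2 * (2 * e)"
      unfolding right_diff_distrib[symmetric] abs_mult by (simp add: mult_ac)
    then show ?thesis using s by simp
  qed
  then have "\<bar>A h \<bullet> k - A k \<bullet> h\<bar> \<le> 0 + e" if "e > 0" for e
    using that by (metis add_0 field_sum_of_halves half_gt_zero mult_2)
  then have "\<bar>A h \<bullet> k - A k \<bullet> h\<bar> \<le> 0" by (rule field_le_epsilon)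
  then show ?thesis by simp
qed

section \<open>The proximal map of a convex function\<close>

lemma norm_add_scaleR_sq:
  fixes a b :: "'a::real_inner"
  shows "(norm (a + t *\<^sub>R b))\<^sup>2 = (norm a)\<^sup>2 + 2 * t * (a \<bullet> b) + t\<^sup>2 * (norm b)\<^sup>2"
  unfolding power2_norm_eq_inner
  by (simp add: inner_add_left inner_add_right inner_commute power2_eq_square algebra_simps)

text \<open>
  Restricting a locally convex function to a compact ball makes the proximal map below a map on the
  whole space, which is the setting of Rademacher's theorem.
\<close>

locale convex_on_compact =
  fixes S :: "'a::euclidean_space set" and f :: "'a \<Rightarrow> real"
  assumes compact: "compact S" and nonempty: "S \<noteq> {}"
    and conv: "convex_on S f" and cont: "continuous_on S f"
begin

definition prox :: "'a \<Rightarrow> 'a" where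
  "prox z = (SOME y. y \<in> S \<and> (\<forall>w\<in>S. f y + (norm (y - z))\<^sup>2 / 2 \<le> f w + (norm (w - z))\<^sup>2 / 2))"

text \<open>
  The Moreau envelope of \<open>f\<close>.
\<close>

definition env :: "'a \<Rightarrow> real" where
  "env z = f (prox z) + (norm (prox z - z))\<^sup>2 / 2"

lemma prox_minimal: "prox z \<in> S \<and> (\<forall>w\<in>S. env z \<le> f w + (norm (w - z))\<^sup>2 / 2)"
proof -
  have "\<exists>y\<in>S. \<forall>w\<in>S. f y + (norm (y - z))\<^sup>2 / 2 \<le> f w + (norm (w - z))\<^sup>2 / 2"
    by (intro continuous_attains_inf compact nonempty continuous_intros cont) auto
  then show ?thesis unfolding env_def prox_def by (rule someI2_bex) blast
qed

lemma prox_mem: "prox z \<in> S" using prox_minimal by blast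

lemma env_le: "w \<in> S \<Longrightarrow> env z \<le> f w + (norm (w - z))\<^sup>2 / 2" using prox_minimal by blast

text \<open>
  The vector \<open>z - prox z\<close> is a subgradient of \<open>f\<close> on \<open>S\<close> at \<open>prox z\<close>: compare the minimiser with
  points at a small distance \<open>t\<close> towards \<open>w\<close>.
\<close>

lemma prox_subgradient:
  assumes w: "w \<in> S"
  shows "(z - prox z) \<bullet> (w - prox z) \<le> f w - f (prox z)"
proof (rule field_le_epsilon)
  fix e :: real assume e: "0 < e"
  define D where "D = (norm (w - prox z))\<^sup>2"
  define t where "t = min 1 (e / (D + 1))"
  have D: "0 \<le> D" by (simp add: D_def)
  have t: "0 < t" "t \<le> 1" using e D by (auto simp: t_def)
  have "t * D \<le> e"
  proof -
    have "t * D \<le> (e / (D + 1)) * (D + 1)" using D t e by (intro mult_mono) (auto simp: t_def)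
    then show ?thesis using D by simp
  qed
  define y where "y = (1 - t) *\<^sub>R prox z + t *\<^sub>R w"
  have "y \<in> S" using conv prox_mem[of z] w t unfolding y_def convex_on_def
    by (auto intro!: convexD)
  then have 1: "f (prox z) + (norm (prox z - z))\<^sup>2 / 2 \<le> f y + (norm (y - z))\<^sup>2 / 2"
    using env_le[of y z] by (simp add: env_def)
  have 2: "f y \<le> (1 - t) * f (prox z) + t * f w"
    using convex_onD[OF conv, of t "prox z" w] t prox_mem w by (auto simp: y_def)
  have "y - z = (prox z - z) + t *\<^sub>R (w - prox z)" by (simp add: y_def algebra_simps)
  then have 3: "(norm (y - z))\<^sup>2 = (norm (prox z - z))\<^sup>2 + 2 * t * ((prox z - z) \<bullet> (w - prox z)) + t\<^sup>2 * D"
    unfolding D_def by (simp only: norm_add_scaleR_sq)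
  have "t * ((z - prox z) \<bullet> (w - prox z)) = - t * ((prox z - z) \<bullet> (w - prox z))"
    by (simp add: inner_diff_left algebra_simps)
  then have "t * ((z - prox z) \<bullet> (w - prox z)) \<le> t * (f w - f (prox z) + t * D / 2)"
    using 1 2 3 by (simp add: algebra_simps power2_eq_square)
  then have "(z - prox z) \<bullet> (w - prox z) \<le> f w - f (prox z) + t * D / 2" using t by simp
  then show "(z - prox z) \<bullet> (w - prox z) \<le> f w - f (prox z) + e" using \<open>t * D \<le> e\<close> e by linarith
qed

lemma prox_nonexpansive: "norm (prox z - prox z') \<le> norm (z - z')"
proof -
  let ?d = "prox z - prox z'"
  have "(z - prox z) \<bullet> (prox z' - prox z) + (z' - prox z') \<bullet> (prox z - prox z') \<le> 0"
    using prox_subgradient[OF prox_mem, of z z'] prox_subgradient[OF prox_mem, of z' z] by linarith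
  then have "(norm ?d)\<^sup>2 \<le> (z - z') \<bullet> ?d"
    by (simp add: power2_norm_eq_inner inner_diff_left inner_diff_right inner_commute)
  also have "\<dots> \<le> norm (z - z') * norm ?d" by (rule norm_cauchy_schwarz)
  finally show ?thesis by (cases "norm ?d = 0") (auto simp: power2_eq_square)
qed

lemma continuous_on_prox: "continuous_on A prox"
  using prox_nonexpansive by (intro lipschitz_on_continuous_on[of 1]) (auto simp: lipschitz_on_def dist_norm)

text \<open>
  Testing minimality at \<open>z + h\<close> with \<open>prox z\<close>, and at \<open>z\<close> with \<open>prox (z + h)\<close>, bounds the increment
  of the envelope from above and from below.
\<close>

lemma env_has_derivative: "(env has_derivative (\<lambda>h. (z - prox z) \<bullet> h)) (at z)"
proof -
  have up: "env (z + h) - env z \<le> (z - prox z) \<bullet> h + (norm h)\<^sup>2 / 2" for z h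
  proof -
    have "env (z + h) \<le> f (prox z) + (norm (prox z - (z + h)))\<^sup>2 / 2" by (rule env_le[OF prox_mem])
    moreover have "(norm (prox z - (z + h)))\<^sup>2 = (norm (prox z - z))\<^sup>2 + 2 * ((z - prox z) \<bullet> h) + (norm h)\<^sup>2"
      by (simp add: power2_norm_eq_inner inner_diff_left inner_diff_right inner_add_left inner_add_right inner_commute algebra_simps)
    ultimately show ?thesis unfolding env_def by linarith
  qed
  have bound: "\<bar>env (z + h) - env z - (z - prox z) \<bullet> h\<bar> \<le> (norm h)\<^sup>2" for h
  proof -
    have "env z - env (z + h) \<le> - ((z + h - prox (z + h)) \<bullet> h) + (norm h)\<^sup>2 / 2"
      using up[of "z + h" "- h"] by simp
    also have "(z + h - prox (z + h)) \<bullet> h = (z - prox z) \<bullet> h + (norm h)\<^sup>2 - (prox (z + h) - prox z) \<bullet> h"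
      by (simp add: power2_norm_eq_inner inner_diff_left inner_add_left algebra_simps)
    also have "(prox (z + h) - prox z) \<bullet> h \<le> norm (prox (z + h) - prox z) * norm h"
      by (rule norm_cauchy_schwarz)
    also have "\<dots> \<le> norm h * norm h"
      using prox_nonexpansive[of "z + h" z] by (intro mult_right_mono) auto
    finally have "env z - env (z + h) \<le> - ((z - prox z) \<bullet> h) + (norm h)\<^sup>2 / 2"
      by (simp add: power2_eq_square)
    with up[of z h] show ?thesis by (simp add: abs_le_iff)
  qed
  show ?thesis unfolding has_derivative_at_alt
  proof (intro conjI allI impI)
    show "bounded_linear ((\<bullet>) (z - prox z))" by (rule bounded_linear_inner_right)
    fix e :: real assume e: "0 < e"
    show "\<exists>d>0. \<forall>y. norm (y - z) < d \<longrightarrow> norm (env y - env z - (z - prox z) \<bullet> (y - z)) \<le> e * norm (y - z)"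
    proof (intro exI[of _ e] conjI allI impI e)
      fix y assume y: "norm (y - z) < e"
      have "norm (env y - env z - (z - prox z) \<bullet> (y - z)) \<le> (norm (y - z))\<^sup>2"
        using bound[of "y - z"] by simp
      also have "\<dots> \<le> e * norm (y - z)"
        using y unfolding power2_eq_square by (intro mult_right_mono) auto
      finally show "norm (env y - env z - (z - prox z) \<bullet> (y - z)) \<le> e * norm (y - z)" .
    qed
  qed
qed

text \<open>
  If \<open>T z = z + x - prox z\<close> has a fixed point \<open>z\<close>, then \<open>prox z = x\<close>. Brouwer's theorem
  applies on a large ball about \<open>x\<close> with radius \<open>m\<close>: since some ball about \<open>x\<close> lies in \<open>S\<close>, the
  distance from \<open>z\<close> to \<open>prox z\<close> is at most \<open>m\<close> as long as \<open>|z - x| \<le> m\<close>.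
\<close>

lemma prox_surjective_onto_interior:
  assumes "x \<in> interior S"
  shows "\<exists>z. prox z = x"
proof -
  obtain r where r: "r > 0" "cball x r \<subseteq> S" using assms mem_interior_cball by blast
  have "compact (f ` S)" using compact cont by (rule compact_continuous_image[rotated])
  then obtain B where B: "\<And>y. y \<in> S \<Longrightarrow> \<bar>f y\<bar> \<le> B"
    using compact_imp_bounded[of "f ` S"] by (auto simp: bounded_iff)
  define O' where "O' = 2 * B"
  have O': "f y - f y' \<le> O'" if "y \<in> S" "y' \<in> S" for y y'
    using B[OF that(1)] B[OF that(2)] by (simp add: O'_def)
  have "0 \<le> O'" using O'[OF prox_mem prox_mem, of z z for z] by simp
  \<comment> \<open>chosen so that \<open>(m - r)\<^sup>2 + 2 O' \<le> m\<^sup>2\<close>, which bounds \<open>|z - prox z|\<close> by \<open>m\<close>\<close>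
  define m where "m = r + O' / r"
  have m: "r \<le> m" "2 * O' \<le> m\<^sup>2" "(m - r)\<^sup>2 + 2 * O' \<le> m\<^sup>2"
    using r \<open>0 \<le> O'\<close> by (auto simp: m_def power2_sum) 
  define T where "T z = z + x - prox z" for z
  have "norm (z - prox z) \<le> m" if z: "norm (z - x) \<le> m" for z
  proof -
    have key: "(norm (z - prox z))\<^sup>2 \<le> (norm (z - y))\<^sup>2 + 2 * O'" if "y \<in> S" for y
    proof -
      have "f (prox z) + (norm (prox z - z))\<^sup>2 / 2 \<le> f y + (norm (y - z))\<^sup>2 / 2"
        using env_le[OF that, of z] by (simp add: env_def)
      then show ?thesis using O'[OF that prox_mem[of z]] by (simp add: norm_minus_commute)
    qed
    have "(norm (z - prox z))\<^sup>2 \<le> m\<^sup>2"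
    proof (cases "norm (z - x) \<le> r")
      case True
      then have "z \<in> S" using r by (auto simp: dist_norm norm_minus_commute)
      from key[OF this] show ?thesis using m by simp
    next
      case False
      then have zx: "norm (z - x) > r" "norm (z - x) > 0" using r by linarith+
      \<comment> \<open>the point of the ball of radius \<open>r\<close> nearest to \<open>z\<close>\<close>
      define y where "y = x + (r / norm (z - x)) *\<^sub>R (z - x)"
      have "norm (y - x) = r" using zx r by (simp add: y_def)
      then have "y \<in> S" using r by (auto simp: dist_norm norm_minus_commute)
      have "z - y = (1 - r / norm (z - x)) *\<^sub>R (z - x)" by (simp add: y_def algebra_simps)
      then have "norm (z - y) = \<bar>1 - r / norm (z - x)\<bar> * norm (z - x)" by simp
      also have "\<dots> = norm (z - x) - r" using zx r by (simp add: field_simps)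
      finally have "(norm (z - y))\<^sup>2 \<le> (m - r)\<^sup>2" using z zx by (simp add: power_mono)
      then show ?thesis using key[OF \<open>y \<in> S\<close>] m by linarith
    qed
    then show ?thesis by (rule power2_le_imp_le) (use m r in linarith)
  qed
  then have "T ` cball x m \<subseteq> cball x m" by (auto simp: T_def dist_norm norm_minus_commute)
  moreover have "continuous_on (cball x m) T" unfolding T_def by (intro continuous_intros continuous_on_prox)
  moreover have "cball x m \<noteq> {}" using m r by simp
  ultimately obtain z where "T z = z"
    using brouwer[of "cball x m" T] by (metis compact_cball convex_cball image_subset_iff_funcset)
  then have "prox z = x" by (simp add: T_def)
  then show ?thesis ..
qed

end

context convex_on_compact
begin

lemma second_order_expansion_env:
  assumes M: "(prox has_derivative M) (at z)"
  shows "second_order_expansion env z (z - prox z) (\<lambda>k. k - M k)"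
proof (rule second_order_Taylor)
  show "((\<lambda>z. z - prox z) has_derivative (\<lambda>k. k - M k)) (at z)"
    using M by (auto intro!: derivative_eq_intros)
qed (auto intro: env_has_derivative zero_less_one)

text \<open>
  If \<open>M k = 0\<close>, the envelope grows at least like \<open>|k|\<^sup>2 / 2\<close> above its tangent in the directions
  \<open>k\<close> and \<open>-k\<close>. Since \<open>f y \<ge> env w - |y - w|\<^sup>2 / 2\<close> for all \<open>w\<close>, the second difference of \<open>f\<close>
  with step \<open>\<theta> k\<close> is then at least about \<open>(2 \<theta> - \<theta>\<^sup>2) |k|\<^sup>2\<close>. For small \<open>\<theta>\<close> the linear term
  in \<open>\<theta>\<close> beats the bound \<open>C \<theta>\<^sup>2 |k|\<^sup>2\<close>.
\<close>

lemma prox_derivative_injective: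
  assumes M: "(prox has_derivative M) (at z)" and int: "prox z \<in> interior S"
    and C: "0 \<le> C" and d: "0 < d"
    and bound: "\<And>h. norm h < d \<Longrightarrow> f (prox z + h) + f (prox z - h) - 2 * f (prox z) \<le> C * (norm h)\<^sup>2"
    and k: "M k = 0"
  shows "k = 0"
proof (rule ccontr)
  assume "k \<noteq> 0"
  interpret M: bounded_linear M using M by (rule has_derivative_bounded_linear)
  \<comment> \<open>the step that turns the bound \<open>2 \<theta> - \<theta>\<^sup>2 - 2 e \<le> C \<theta>\<^sup>2\<close> into \<open>\<theta> \<le> 2 e\<close>\<close>
  define \<theta> where "\<theta> = 1 / (C + 1)"
  have \<theta>: "0 < \<theta>" "\<theta> \<le> 1" "C * \<theta>\<^sup>2 + \<theta>\<^sup>2 = \<theta>"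
  proof -
    have "(C + 1) * \<theta> = 1" using C by (simp add: \<theta>_def)
    then have "(C + 1) * \<theta> * \<theta> = \<theta>" by simp
    then show "C * \<theta>\<^sup>2 + \<theta>\<^sup>2 = \<theta>" by (simp add: power2_eq_square algebra_simps)
  qed (use C in \<open>auto simp: \<theta>_def\<close>)
  define e where "e = \<theta> / 4"
  have e: "e > 0" using \<theta> by (simp add: e_def)
  obtain d1 where d1: "d1 > 0"
    "\<And>h. norm h < d1 \<Longrightarrow> \<bar>env (z + h) - env z - (z - prox z) \<bullet> h - (h - M h) \<bullet> h / 2\<bar> \<le> e * (norm h)\<^sup>2"
    using second_order_expansion_env[OF M] e unfolding second_order_expansion_def by blast
  obtain r where r: "r > 0" "cball (prox z) r \<subseteq> S" using int mem_interior_cball by blast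
  define s where "s = min d1 (min d r) / (2 * norm k)"
  define k' where "k' = s *\<^sub>R k"
  have "norm k' = min d1 (min d r) / 2" using \<open>k \<noteq> 0\<close> d1 d r by (simp add: k'_def s_def)
  then have k': "0 < norm k'" "norm k' < d1" "norm k' < d" "norm k' < r" using d1 d r by auto
  have Mk': "M k' = 0" by (simp add: k'_def M.scaleR k)
  have low: "f (prox z + \<theta> *\<^sub>R y) \<ge> f (prox z) + \<theta> * ((z - prox z) \<bullet> y) + (norm y)\<^sup>2 * (\<theta> - \<theta>\<^sup>2 / 2 - e)"
    if y: "norm y = norm k'" "M y = 0" for y
  proof -
    have n: "norm (\<theta> *\<^sub>R y) \<le> norm k'" using \<theta> y by (simp add: mult_left_le_one_le)
    then have "prox z + \<theta> *\<^sub>R y \<in> S" using r k' by (auto simp: dist_norm)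
    then have "env (z + y) \<le> f (prox z + \<theta> *\<^sub>R y) + (norm (prox z + \<theta> *\<^sub>R y - (z + y)))\<^sup>2 / 2" by (rule env_le)
    moreover have "prox z + \<theta> *\<^sub>R y - (z + y) = (prox z - z) + (\<theta> - 1) *\<^sub>R y" by (simp add: algebra_simps)
    then have "(norm (prox z + \<theta> *\<^sub>R y - (z + y)))\<^sup>2
       = (norm (prox z - z))\<^sup>2 + 2 * (\<theta> - 1) * ((prox z - z) \<bullet> y) + (\<theta> - 1)\<^sup>2 * (norm y)\<^sup>2"
      by (simp only: norm_add_scaleR_sq)
    moreover have "(prox z - z) \<bullet> y = - ((z - prox z) \<bullet> y)" by (simp add: inner_diff_left)
    moreover have "env (z + y) \<ge> env z + (z - prox z) \<bullet> y + (norm y)\<^sup>2 / 2 - e * (norm y)\<^sup>2"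
    proof -
      have "(y - M y) \<bullet> y = (norm y)\<^sup>2" using y(2) by (simp add: power2_norm_eq_inner)
      then show ?thesis using d1(2)[of y] y(1) k'(2) by linarith
    qed
    ultimately show ?thesis
      by (simp add: env_def field_simps power2_eq_square)
  qed
  have "norm (\<theta> *\<^sub>R k') \<le> norm k'" using \<theta> by (simp add: mult_left_le_one_le)
  then have "f (prox z + \<theta> *\<^sub>R k') + f (prox z - \<theta> *\<^sub>R k') - 2 * f (prox z) \<le> C * (norm (\<theta> *\<^sub>R k'))\<^sup>2"
    using k'(3) by (intro bound) (rule le_less_trans)
  then have "2 * ((norm k')\<^sup>2 * (\<theta> - \<theta>\<^sup>2 / 2 - e)) \<le> C * (norm (\<theta> *\<^sub>R k'))\<^sup>2"
    using low[of k'] low[of "- k'"] Mk' by (simp add: M.neg)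
  then have "(norm k')\<^sup>2 * (2 * \<theta> - \<theta>\<^sup>2 - 2 * e) \<le> (norm k')\<^sup>2 * (C * \<theta>\<^sup>2)"
    by (simp add: power_mult_distrib algebra_simps)
  then have "2 * \<theta> - \<theta>\<^sup>2 - 2 * e \<le> C * \<theta>\<^sup>2" using k' by simp
  then show False using \<theta> by (simp add: e_def)
qed

text \<open>
  Given a small \<open>h\<close>, Brouwer's theorem yields \<open>k\<close> with \<open>prox (z + k) = prox z + h\<close> and
  \<open>k = B h + o(|h|)\<close>, where \<open>B\<close>
  is the inverse of \<open>M\<close>; the inverse function theorem does not apply, since \<open>prox\<close> may fail
  to be differentiable arbitrarily near \<open>z\<close>. For this \<open>k\<close> the value \<open>f (prox z + h)\<close> is
  \<open>env (z + k) - |prox z + h - z - k|\<^sup>2 / 2\<close>, and inserting the expansion of the envelope gives the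
  quadratic form of \<open>B - I\<close>.
\<close>

lemma second_order_expansion_at_prox:
  assumes M: "(prox has_derivative M) (at z)" and inj: "\<And>k. M k = 0 \<Longrightarrow> k = 0"
  shows "\<exists>A. linear A \<and> second_order_expansion f (prox z) (z - prox z) A"
proof -
  interpret M: bounded_linear M using M by (rule has_derivative_bounded_linear)
  have "inj M" using inj by (simp add: linear_injective_0 M.linear_axioms M.linear)
  then obtain B where B: "linear B" "\<And>x. B (M x) = x" "\<And>x. M (B x) = x"
    using linear_injective_isomorphism[of M] M.linear by blast
  interpret B: linear B by (rule B)
  obtain b where b: "b > 0" "\<And>x. norm (B x) \<le> b * norm x" using linear_bounded_pos[OF B(1)] by blast
  let ?x = "prox z" and ?p = "z - prox z"
  have "second_order_expansion f ?x ?p (\<lambda>h. B h - h)"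
    unfolding second_order_expansion_def
  proof (intro allI impI)
    fix e :: real assume e: "0 < e"
    \<comment> \<open>The first bound makes the Brouwer map send the ball of radius \<open>2 b |h|\<close> into itself; the second absorbs the total error \<open>7 b\<^sup>2 \<kappa> |h|\<^sup>2\<close>.\<close>
    define \<kappa> where "\<kappa> = min (1 / (2 * b)) (e / (7 * b\<^sup>2))"
    have \<kappa>: "0 < \<kappa>" "b * \<kappa> \<le> 1 / 2" "7 * b\<^sup>2 * \<kappa> \<le> e"
      using b e by (auto simp: \<kappa>_def min_def field_simps)
    obtain d1 where d1: "d1 > 0"
      "\<And>k. norm k < d1 \<Longrightarrow> \<bar>env (z + k) - env z - ?p \<bullet> k - (k - M k) \<bullet> k / 2\<bar> \<le> \<kappa> * (norm k)\<^sup>2"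
      using second_order_expansion_env[OF M] \<kappa>(1) unfolding second_order_expansion_def by blast
    obtain d2 where d2: "d2 > 0" "\<And>k. norm k < d2 \<Longrightarrow> norm (prox (z + k) - ?x - M k) \<le> \<kappa> * norm k"
      using M[unfolded has_derivative_at_alt] \<kappa>(1) by (metis add_diff_cancel_left')
    define d where "d = min d1 d2 / (2 * b)"
    have "d > 0" using d1 d2 b by (simp add: d_def)
    moreover have "\<bar>f (?x + h) - f ?x - ?p \<bullet> h - (B h - h) \<bullet> h / 2\<bar> \<le> e * (norm h)\<^sup>2" if h: "norm h < d" for h
    proof -
      define R where "R = 2 * b * norm h"
      have R: "0 \<le> R" "R < d1" "R < d2" using h b by (auto simp: R_def d_def field_simps)
      \<comment> \<open>a fixed point of this map is a solution of \<open>prox (z + k) = ?x + h\<close>\<close>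
      define T where "T k = k + B (h - (prox (z + k) - ?x))" for k
      have "norm (T k) \<le> R" if k: "norm k \<le> R" for k
      proof -
        have "T k = B h + B (M k - (prox (z + k) - ?x))" by (simp add: T_def B.diff B.add B(2))
        also have "norm \<dots> \<le> b * norm h + b * norm (M k - (prox (z + k) - ?x))"
          by (intro norm_triangle_le add_mono b)
        also have "norm (M k - (prox (z + k) - ?x)) \<le> \<kappa> * norm k"
          using d2(2)[of k] k R by (simp add: norm_minus_commute)
        also have "b * norm h + b * (\<kappa> * norm k) \<le> b * norm h + 1 / 2 * R"
          using mult_mono[OF \<kappa>(2) k] b by (simp add: mult.assoc)
        finally show ?thesis using b by (simp add: R_def)
      qed
      then have "T ` cball 0 R \<subseteq> cball 0 R" by auto
      moreover have "continuous_on (cball 0 R) T"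
        unfolding T_def
        by (intro continuous_intros linear_continuous_on_compose[OF _ B(1)] continuous_on_compose2[OF continuous_on_prox[of UNIV]]) auto
      moreover have "cball 0 R \<noteq> ({} :: 'a set)" using R by simp
      ultimately obtain k where k: "k \<in> cball 0 R" "T k = k"
        using brouwer[of "cball 0 R" T] by (metis compact_cball convex_cball image_subset_iff_funcset)
      have "B (h - (prox (z + k) - ?x)) = 0" using k(2) by (simp add: T_def)
      then have "M (B (h - (prox (z + k) - ?x))) = M 0" by simp
      then have px: "prox (z + k) = ?x + h" by (simp add: B(3) M.zero algebra_simps)
      have kR: "norm k \<le> R" using k by simp
      define \<delta> where "\<delta> = h - M k"
      have \<delta>: "norm \<delta> \<le> \<kappa> * R"
      proof -
        have "norm \<delta> \<le> \<kappa> * norm k" using d2(2)[of k] kR R px by (simp add: \<delta>_def)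
        also have "\<dots> \<le> \<kappa> * R" using kR \<kappa> by simp
        finally show ?thesis .
      qed
      have "k = B h - B \<delta>" by (simp add: \<delta>_def B.diff B(2))
      have kh: "k \<bullet> h = B h \<bullet> h - B \<delta> \<bullet> h" by (subst \<open>k = _\<close>) (simp add: inner_diff_left)
      have "env (z + k) = f (?x + h) + (norm (?x + h - (z + k)))\<^sup>2 / 2" by (simp add: env_def px)
      moreover have "(norm (?x + h - (z + k)))\<^sup>2 = (norm (?x - z))\<^sup>2 - 2 * (?p \<bullet> h) + 2 * (?p \<bullet> k) + h \<bullet> h - 2 * (k \<bullet> h) + k \<bullet> k"
        by (simp add: power2_norm_eq_inner inner_diff_left inner_diff_right inner_add_left inner_add_right inner_commute)
      moreover have "(k - M k) \<bullet> k = k \<bullet> k - k \<bullet> h + k \<bullet> \<delta>"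
        by (simp add: \<delta>_def inner_diff_left inner_diff_right inner_commute)
      ultimately have eq: "f (?x + h) - f ?x - ?p \<bullet> h - (B h - h) \<bullet> h / 2
          = (env (z + k) - env z - ?p \<bullet> k - (k - M k) \<bullet> k / 2) + (k \<bullet> \<delta> - B \<delta> \<bullet> h) / 2"
        using kh by (simp add: env_def inner_diff_left field_simps)
      have "\<bar>k \<bullet> \<delta>\<bar> \<le> R * (\<kappa> * R)"
        using order_trans[OF Cauchy_Schwarz_ineq2 mult_mono[OF kR \<delta>]] R by auto
      moreover have "\<bar>B \<delta> \<bullet> h\<bar> \<le> (b * (\<kappa> * R)) * norm h"
      proof (rule order_trans[OF Cauchy_Schwarz_ineq2 mult_right_mono])
        show "norm (B \<delta>) \<le> b * (\<kappa> * R)"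
          using order_trans[OF b(2)[of \<delta>] mult_left_mono[OF \<delta>]] b by simp
      qed simp
      moreover have "\<bar>env (z + k) - env z - ?p \<bullet> k - (k - M k) \<bullet> k / 2\<bar> \<le> \<kappa> * R\<^sup>2"
      proof -
        have "\<kappa> * (norm k)\<^sup>2 \<le> \<kappa> * R\<^sup>2" using kR \<kappa> by (simp add: power_mono)
        then show ?thesis using d1(2)[of k] kR R by linarith
      qed
      moreover have "\<bar>u + (v - w) / 2\<bar> \<le> U + (V + W) / 2"
        if "\<bar>v\<bar> \<le> V" "\<bar>w\<bar> \<le> W" "\<bar>u\<bar> \<le> U" for u v w U V W :: real
        using that by (simp add: abs_le_iff field_simps)
      ultimately have "\<bar>f (?x + h) - f ?x - ?p \<bullet> h - (B h - h) \<bullet> h / 2\<bar>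
          \<le> \<kappa> * R\<^sup>2 + (R * (\<kappa> * R) + (b * (\<kappa> * R)) * norm h) / 2"
        unfolding eq by blast
      also have "\<dots> = 7 * b\<^sup>2 * \<kappa> * (norm h)\<^sup>2"
        by (simp add: R_def power2_eq_square field_simps)
      also have "\<dots> \<le> e * (norm h)\<^sup>2" using \<kappa> by (intro mult_right_mono) auto
      finally show ?thesis .
    qed
    ultimately show "\<exists>d>0. \<forall>h. norm h < d \<longrightarrow> \<bar>f (?x + h) - f ?x - ?p \<bullet> h - (B h - h) \<bullet> h / 2\<bar> \<le> e * (norm h)\<^sup>2"
      by blast
  qed
  moreover have "linear (\<lambda>h. B h - h)" by (intro linear_compose_sub B linear_ident)
  ultimately show ?thesis by blast
qed

end

section \<open>Aleksandrov expansions and their calculus\<close>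

context convex_on_compact
begin

text \<open>
  The exceptional set is the image under \<open>prox\<close> of the points where \<open>prox\<close> is not differentiable.
\<close>

lemma second_order_expansion_off_null_set:
  "\<exists>N. negligible N \<and> (\<forall>x\<in>interior S - N. \<forall>C d. 0 < d \<longrightarrow>
     (\<forall>h. norm h < d \<longrightarrow> f (x + h) + f (x - h) - 2 * f x \<le> C * (norm h)\<^sup>2) \<longrightarrow>
     (\<exists>p A. linear A \<and> second_order_expansion f x p A))"
proof (rule exI[of _ "prox ` {z. \<not> prox differentiable (at z)}"], rule conjI)
  have lip: "norm (prox x - prox y) \<le> 1 * norm (x - y)" for x y using prox_nonexpansive by simp
  show "negligible (prox ` {z. \<not> prox differentiable (at z)})"
  proof (rule negligible_locally_Lipschitz_image)
    show "negligible {z. \<not> prox differentiable (at z)}" using lip by (rule Rademacher)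
    fix x show "\<exists>T B. open T \<and> x \<in> T \<and>
        (\<forall>y\<in>{z. \<not> prox differentiable (at z)} \<inter> T. norm (prox y - prox x) \<le> B * norm (y - x))"
      using lip by (intro exI[of _ UNIV] exI[of _ 1]) auto
  qed simp
next
  have "\<exists>p A. linear A \<and> second_order_expansion f x p A"
    if x: "x \<in> interior S - prox ` {z. \<not> prox differentiable (at z)}" and d: "0 < d"
    and bound: "\<forall>h. norm h < d \<longrightarrow> f (x + h) + f (x - h) - 2 * f x \<le> C * (norm h)\<^sup>2" for x C d
  proof -
  obtain z where z: "prox z = x" using prox_surjective_onto_interior x by blast
  with x have "prox differentiable (at z)" by blast
  then obtain M where M: "(prox has_derivative M) (at z)" by (auto simp: differentiable_def)
  have "k = 0" if k: "M k = 0" for k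
  proof (rule prox_derivative_injective[OF M _ _ d _ k])
    show "prox z \<in> interior S" using x z by simp
    show "0 \<le> max C 0" by simp
    fix h :: 'a assume "norm h < d"
    then have "f (x + h) + f (x - h) - 2 * f x \<le> C * (norm h)\<^sup>2" using bound by blast
    also have "\<dots> \<le> max C 0 * (norm h)\<^sup>2" by (intro mult_right_mono) auto
    finally show "f (prox z + h) + f (prox z - h) - 2 * f (prox z) \<le> max C 0 * (norm h)\<^sup>2" by (simp add: z)
  qed
  with second_order_expansion_at_prox[OF M] z
  show ?thesis by blast
  qed
  then show "\<forall>x\<in>interior S - prox ` {z. \<not> prox differentiable (at z)}. \<forall>C d. 0 < d \<longrightarrow>
     (\<forall>h. norm h < d \<longrightarrow> f (x + h) + f (x - h) - 2 * f x \<le> C * (norm h)\<^sup>2) \<longrightarrow>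
     (\<exists>p A. linear A \<and> second_order_expansion f x p A)" by blast
qed

end

lemma second_order_expansion_add:
  assumes f: "second_order_expansion f x p A" and g: "second_order_expansion g x q B"
  shows "second_order_expansion (\<lambda>y. f y + g y) x (p + q) (\<lambda>h. A h + B h)"
  unfolding second_order_expansion_def
proof (intro allI impI)
  fix e :: real assume "0 < e"
  then have e: "0 < e / 2" by simp
  obtain d1 where d1: "d1 > 0" "\<And>h. norm h < d1 \<Longrightarrow> \<bar>f (x + h) - f x - p \<bullet> h - A h \<bullet> h / 2\<bar> \<le> e / 2 * (norm h)\<^sup>2"
    using f e unfolding second_order_expansion_def by blast
  obtain d2 where d2: "d2 > 0" "\<And>h. norm h < d2 \<Longrightarrow> \<bar>g (x + h) - g x - q \<bullet> h - B h \<bullet> h / 2\<bar> \<le> e / 2 * (norm h)\<^sup>2"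
    using g e unfolding second_order_expansion_def by blast
  have "\<bar>(f (x + h) + g (x + h)) - (f x + g x) - (p + q) \<bullet> h - (A h + B h) \<bullet> h / 2\<bar> \<le> e * (norm h)\<^sup>2"
    if "norm h < min d1 d2" for h
  proof -
    have "(f (x + h) + g (x + h)) - (f x + g x) - (p + q) \<bullet> h - (A h + B h) \<bullet> h / 2 =
       (f (x + h) - f x - p \<bullet> h - A h \<bullet> h / 2) + (g (x + h) - g x - q \<bullet> h - B h \<bullet> h / 2)"
      by (simp add: inner_add_left add_divide_distrib)
    also have "\<bar>\<dots>\<bar> \<le> e / 2 * (norm h)\<^sup>2 + e / 2 * (norm h)\<^sup>2"
      using d1(2)[of h] d2(2)[of h] that by (intro order_trans[OF abs_triangle_ineq add_mono]) auto
    finally show ?thesis by simp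
  qed
  then show "\<exists>d>0. \<forall>h. norm h < d \<longrightarrow>
      \<bar>(f (x + h) + g (x + h)) - (f x + g x) - (p + q) \<bullet> h - (A h + B h) \<bullet> h / 2\<bar> \<le> e * (norm h)\<^sup>2"
    using d1 d2 by (intro exI[of _ "min d1 d2"]) auto
qed

lemma second_order_expansion_quadratic:
  assumes L: "linear L" and sym: "\<And>h k. L h \<bullet> k = L k \<bullet> h"
  shows "second_order_expansion (\<lambda>y. c + a \<bullet> (y - x0) + L (y - x0) \<bullet> (y - x0) / 2) x (a + L (x - x0)) L"
proof -
  interpret linear L by (rule L)
  have "L (x + h - x0) = L (x - x0) + L h" for h
    by (metis add add_diff_eq add.commute)
  then have "c + a \<bullet> (x + h - x0) + L (x + h - x0) \<bullet> (x + h - x0) / 2 - (c + a \<bullet> (x - x0) + L (x - x0) \<bullet> (x - x0) / 2)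
     - (a + L (x - x0)) \<bullet> h - L h \<bullet> h / 2 = 0" for h
    using sym[of h "x - x0"] by (simp add: inner_add_left inner_add_right inner_diff_right field_simps)
  then show ?thesis
    unfolding second_order_expansion_def by (intro allI impI exI[of _ 1] conjI) (simp_all only:, simp_all)
qed

text \<open>
  First- and second-order conditions at a maximum, read off from the expansion along \<open>h = s k\<close> as
  \<open>s\<close> decreases to zero.
\<close>

lemma second_order_expansion_local_max:
  assumes f: "second_order_expansion f x p A" and A: "linear A"
    and d: "0 < d" and max: "\<And>h. norm h < d \<Longrightarrow> f (x + h) \<le> f x"
  shows "p = 0" "A k \<bullet> k \<le> 0"
proof -
  interpret linear A by (rule A)
  have ev: "\<exists>d>0. \<forall>s. 0 < s \<longrightarrow> s < d \<longrightarrow> p \<bullet> k + s * (A k \<bullet> k) / 2 \<le> e * s" if e: "e > 0" for e k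
  proof -
    define e' where "e' = e / ((norm k)\<^sup>2 + 1)"
    have k1: "(norm k)\<^sup>2 + 1 > 0" by (simp add: add_nonneg_pos)
    have e': "e' > 0" "e' * (norm k)\<^sup>2 \<le> e"
      using e k1 by (auto simp: e'_def field_simps)
    obtain d1 where d1: "d1 > 0" "\<And>h. norm h < d1 \<Longrightarrow> \<bar>f (x + h) - f x - p \<bullet> h - A h \<bullet> h / 2\<bar> \<le> e' * (norm h)\<^sup>2"
      using f e' unfolding second_order_expansion_def by blast
    define \<delta> where "\<delta> = min d d1 / (norm k + 1)"
    have "p \<bullet> k + s * (A k \<bullet> k) / 2 \<le> e * s" if s: "0 < s" "s < \<delta>" for s
    proof -
      have "s * norm k \<le> s * (norm k + 1)" using s by simp
      also have "\<dots> < min d d1" using s by (simp add: \<delta>_def pos_less_divide_eq add_nonneg_pos)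
      finally have n: "norm (s *\<^sub>R k) < min d d1" using s by simp
      have "p \<bullet> (s *\<^sub>R k) + A (s *\<^sub>R k) \<bullet> (s *\<^sub>R k) / 2 \<le> e' * (norm (s *\<^sub>R k))\<^sup>2"
        using max[of "s *\<^sub>R k"] d1(2)[of "s *\<^sub>R k"] n by (auto simp: abs_le_iff)
      then have "s * (p \<bullet> k + s * (A k \<bullet> k) / 2) \<le> s * (s * (e' * (norm k)\<^sup>2))"
        by (simp add: scale power_mult_distrib power2_eq_square algebra_simps)
      then have "p \<bullet> k + s * (A k \<bullet> k) / 2 \<le> s * (e' * (norm k)\<^sup>2)" using s by simp
      also have "\<dots> \<le> s * e" using e' s by (intro mult_left_mono) auto
      finally show ?thesis by (simp add: mult.commute)
    qed
    moreover have "\<delta> > 0" using d d1 by (simp add: \<delta>_def add_nonneg_pos)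
    ultimately show ?thesis by blast
  qed
  show "p = 0"
  proof (rule ccontr)
    assume "p \<noteq> 0"
    then have pp: "p \<bullet> p > 0" by simp
    obtain d' where d': "d' > 0" "\<And>s. 0 < s \<Longrightarrow> s < d' \<Longrightarrow> p \<bullet> p + s * (A p \<bullet> p) / 2 \<le> 1 * s"
      using ev[of 1 p] by auto
    define c where "c = 1 + \<bar>A p \<bullet> p\<bar> / 2"
    have c: "c > 0" by (simp add: c_def add_pos_nonneg)
    define s where "s = min (d' / 2) (p \<bullet> p / (2 * c))"
    have "0 < s" using d'(1) pp c by (simp add: s_def)
    moreover have "s \<le> d' / 2" "s \<le> p \<bullet> p / (2 * c)" by (simp_all add: s_def)
    ultimately have s: "0 < s" "s < d'" "s * (2 * c) \<le> p \<bullet> p" using d'(1) c by (simp_all add: pos_le_divide_eq)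
    have "s * (- (A p \<bullet> p)) \<le> s * \<bar>A p \<bullet> p\<bar>" using s by (intro mult_left_mono) auto
    then have "p \<bullet> p \<le> s * c" using d'(2)[OF s(1,2)] by (simp add: c_def algebra_simps)
    then show False using s(3) pp by simp
  qed
  have "A k \<bullet> k / 2 \<le> 0 + e" if "e > 0" for e
  proof -
    obtain d' where d': "d' > 0" "\<And>s. 0 < s \<Longrightarrow> s < d' \<Longrightarrow> p \<bullet> k + s * (A k \<bullet> k) / 2 \<le> e * s"
      using ev[OF \<open>e > 0\<close>, of k] by auto
    have "(d' / 2) * (A k \<bullet> k / 2) \<le> (d' / 2) * e" using d'(2)[of "d'/2"] d'(1) \<open>p = 0\<close> by (simp add: algebra_simps)
    then show ?thesis using d'(1) by (simp only: mult_le_cancel_left_pos half_gt_zero add_0)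
  qed
  then have "A k \<bullet> k / 2 \<le> 0" by (rule field_le_epsilon)
  then show "A k \<bullet> k \<le> 0" by simp
qed

text \<open>
  Adding \<open>\<mu> |y|\<^sup>2 / 2\<close> makes \<open>u\<close> convex; this function has the exact expansion with form
  \<open>\<mu> I\<close>, which is subtracted again.
\<close>

lemma semiconvex_second_order_expansion_off_null_set:
  fixes u :: "'a::euclidean_space \<Rightarrow> real"
  assumes conv: "convex_on (cball x0 R) (\<lambda>y. u y + \<mu> / 2 * (norm y)\<^sup>2)" and cont: "continuous_on (cball x0 R) u"
    and R: "0 < R"
  shows "\<exists>N. negligible N \<and> (\<forall>x\<in>ball x0 R - N. \<forall>C d. 0 < d \<longrightarrow>
     (\<forall>h. norm h < d \<longrightarrow> u (x + h) + u (x - h) - 2 * u x \<le> C * (norm h)\<^sup>2) \<longrightarrow>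
     (\<exists>p A. linear A \<and> second_order_expansion u x p A))"
proof -
  define f where "f y = u y + \<mu> / 2 * (norm y)\<^sup>2" for y
  interpret convex_on_compact "cball x0 R" f
  proof
    show "cball x0 R \<noteq> {}" using R by simp
    show "continuous_on (cball x0 R) f" unfolding f_def by (intro continuous_intros cont)
  qed (use conv in \<open>auto simp: f_def[abs_def]\<close>)
  obtain N where N: "negligible N" and
    exp: "\<And>x C d. x \<in> interior (cball x0 R) - N \<Longrightarrow> 0 < d \<Longrightarrow>
     (\<forall>h. norm h < d \<longrightarrow> f (x + h) + f (x - h) - 2 * f x \<le> C * (norm h)\<^sup>2) \<Longrightarrow>
     (\<exists>p A. linear A \<and> second_order_expansion f x p A)"
    using second_order_expansion_off_null_set by metis
  have "\<exists>p A. linear A \<and> second_order_expansion u x p A"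
    if x: "x \<in> ball x0 R - N" and d: "0 < d"
      and bound: "\<forall>h. norm h < d \<longrightarrow> u (x + h) + u (x - h) - 2 * u x \<le> C * (norm h)\<^sup>2" for x C d
  proof -
    have "\<exists>p A. linear A \<and> second_order_expansion f x p A"
    proof (rule exp[OF _ d, of _ "C + \<mu>"])
      show "x \<in> interior (cball x0 R) - N" using x by (simp add: interior_cball)
      show "\<forall>h. norm h < d \<longrightarrow> f (x + h) + f (x - h) - 2 * f x \<le> (C + \<mu>) * (norm h)\<^sup>2"
      proof (intro allI impI)
        fix h :: 'a assume "norm h < d"
        then have "u (x + h) + u (x - h) - 2 * u x \<le> C * (norm h)\<^sup>2" using bound by blast
        moreover have "(norm (x + h))\<^sup>2 + (norm (x - h))\<^sup>2 = 2 * (norm x)\<^sup>2 + 2 * (norm h)\<^sup>2"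
          by (simp add: power2_norm_eq_inner inner_add_left inner_add_right inner_diff_left inner_diff_right)
        then have "\<mu> / 2 * (norm (x + h))\<^sup>2 + \<mu> / 2 * (norm (x - h))\<^sup>2 = \<mu> * (norm x)\<^sup>2 + \<mu> * (norm h)\<^sup>2"
          unfolding distrib_left[symmetric] by simp
        ultimately show "f (x + h) + f (x - h) - 2 * f x \<le> (C + \<mu>) * (norm h)\<^sup>2"
          unfolding f_def by (simp add: distrib_right)
      qed
    qed
    then obtain p A where A: "linear A" "second_order_expansion f x p A" by blast
    have lin: "linear (\<lambda>h::'a. (- \<mu>) *\<^sub>R h)" by (intro linear_compose_scale_right linear_ident)
    have "second_order_expansion (\<lambda>y. 0 + 0 \<bullet> (y - 0) + ((- \<mu>) *\<^sub>R (y - 0)) \<bullet> (y - 0) / 2) x (0 + (- \<mu>) *\<^sub>R (x - 0)) (\<lambda>h. (- \<mu>) *\<^sub>R h)"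
      by (rule second_order_expansion_quadratic[OF lin]) (simp add: inner_commute)
    from second_order_expansion_add[OF A(2) this]
    have "second_order_expansion u x (p + (- \<mu>) *\<^sub>R x) (\<lambda>h. A h + (- \<mu>) *\<^sub>R h)"
      by (simp add: f_def power2_norm_eq_inner)
    moreover have "linear (\<lambda>h. A h + (- \<mu>) *\<^sub>R h)" by (intro linear_compose_add A lin)
    ultimately show ?thesis by blast
  qed
  then have all: "\<forall>x\<in>ball x0 R - N. \<forall>C d. 0 < d \<longrightarrow>
     (\<forall>h. norm h < d \<longrightarrow> u (x + h) + u (x - h) - 2 * u x \<le> C * (norm h)\<^sup>2) \<longrightarrow>
     (\<exists>p A. linear A \<and> second_order_expansion u x p A)"
    by (intro ballI allI impI)
  show ?thesis by (rule exI, rule conjI[OF N all])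
qed

section \<open>Jensen's lemma on contact points\<close>

text \<open>
  Each slope bounds \<open>w\<close> from above by an affine function, and at its contact point also from below up
  to \<open>m |z - x|\<^sup>2\<close>, because the second differences are bounded below. If two slopes \<open>p\<close> and \<open>q\<close>
  differ, going from \<open>y\<close> in the direction \<open>p - q\<close> by a distance comparable with \<open>|x - y|\<close> plays
  the lower bound at \<open>x\<close> against the upper bound at \<open>y\<close>.
\<close>

lemma Jensen_contact_slopes_Lipschitz:
  fixes w :: "'a::euclidean_space \<Rightarrow> real"
  assumes semi: "\<And>x h. x + h \<in> ball x0 R \<Longrightarrow> x - h \<in> ball x0 R \<Longrightarrow> w (x + h) + w (x - h) - 2 * w x \<ge> - m * (norm h)\<^sup>2"
    and m: "0 \<le> m" and r: "0 < r" "6 * r \<le> R" and xy: "x \<in> ball x0 r" "y \<in> ball x0 r"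
    and p: "\<And>z. z \<in> cball x0 R \<Longrightarrow> w z - p \<bullet> z \<le> w x - p \<bullet> x"
    and q: "\<And>z. z \<in> cball x0 R \<Longrightarrow> w z - q \<bullet> z \<le> w y - q \<bullet> y"
  shows "norm (p - q) \<le> 4 * m * norm (x - y)"
proof -
  have main: "norm (p - q) \<le> 4 * m * t" if t: "0 < t" "norm (x - y) \<le> t" "t \<le> 2 * r" for t
  proof (cases "p = q")
    case True then show ?thesis using m t by simp
  next
    case False
    define z where "z = y + (t / norm (p - q)) *\<^sub>R (p - q)"
    have zy: "norm (z - y) = t" using False t by (simp add: z_def)
    have "norm (z - x) \<le> norm (z - y) + norm (y - x)" using norm_triangle_ineq[of "z - y" "y - x"] by simp
    then have zx: "norm (z - x) \<le> 2 * t" using zy t by (simp add: norm_minus_commute)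
    have nx: "norm (x - x0) < r" "norm (y - x0) < r" using xy by (auto simp: dist_norm norm_minus_commute)
    have "norm (z - x0) < 3 * r"
      using norm_triangle_ineq[of "z - y" "y - x0"] zy nx t by simp
    then have zb: "z \<in> ball x0 R" using r by (simp add: dist_norm norm_minus_commute)
    have "norm (x - (z - x) - x0) \<le> norm (x - x0) + norm (z - x)"
      using norm_triangle_ineq4[of "x - x0" "z - x"] by (simp add: algebra_simps)
    also have "\<dots> < R" using nx zx t r by linarith
    finally have zb': "x - (z - x) \<in> ball x0 R" by (simp add: dist_norm norm_minus_commute)
    have "w z + w (x - (z - x)) - 2 * w x \<ge> - m * (norm (z - x))\<^sup>2"
      using semi[of x "z - x"] zb zb' by simp
    moreover have "w (x - (z - x)) \<le> w x - p \<bullet> (z - x)"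
      using p[of "x - (z - x)"] zb' by (simp add: inner_diff_right)
    ultimately have 1: "w z \<ge> w x + p \<bullet> (z - x) - m * (norm (z - x))\<^sup>2" by simp
    have 2: "w z \<le> w y + q \<bullet> (z - y)" using q[of z] zb by (simp add: inner_diff_right)
    have "y \<in> cball x0 R" using xy r by auto
    then have 3: "w y \<le> w x + p \<bullet> (y - x)" using p[of y] by (simp add: inner_diff_right)
    have "(p - q) \<bullet> (z - y) \<le> m * (norm (z - x))\<^sup>2"
      using 1 2 3 by (simp add: inner_diff_left inner_diff_right)
    also have "\<dots> \<le> m * (2 * t)\<^sup>2" using zx m t by (intro mult_left_mono power_mono) auto
    also have "(p - q) \<bullet> (z - y) = t * norm (p - q)"
      using False by (simp add: z_def power2_norm_eq_inner[symmetric] power2_eq_square)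
    finally have "t * norm (p - q) \<le> t * (4 * m * t)" by (simp add: power2_eq_square algebra_simps)
    then show ?thesis using t by simp
  qed
  show ?thesis
  proof (cases "x = y")
    case False
    have "norm (x - y) \<le> norm (x - x0) + norm (y - x0)"
      using norm_triangle_ineq4[of "x - x0" "y - x0"] by simp
    then have "norm (x - y) \<le> 2 * r" using xy by (simp add: dist_norm norm_minus_commute)
    then show ?thesis using main[of "norm (x - y)"] False by simp
  next
    case True
    have "norm (p - q) \<le> 0 + e" if e: "e > 0" for e
    proof -
      define t where "t = min (2 * r) (e / (4 * m + 1))"
      have t: "0 < t" "t \<le> 2 * r" using e r m by (auto simp: t_def)
      have "4 * m * t \<le> (4 * m + 1) * (e / (4 * m + 1))" using m t by (intro mult_mono) (auto simp: t_def)
      also have "\<dots> = e" using m by (simp add: add_nonneg_eq_0_iff)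
      finally show ?thesis using main[of t] t True by simp
    qed
    then have "norm (p - q) \<le> 0" by (rule field_le_epsilon)
    then show ?thesis using True by simp
  qed
qed

text \<open>
  The contact point of every sufficiently small slope lies close to \<open>x0\<close>, because the maximum at
  \<open>x0\<close> is strict with a quadratic margin. Hence the slope, as a Lipschitz function on the contact
  set, is onto a ball.
\<close>

lemma Jensen_contact_set_not_negligible:
  fixes w :: "'a::euclidean_space \<Rightarrow> real"
  assumes semi: "\<And>x h. x + h \<in> ball x0 R \<Longrightarrow> x - h \<in> ball x0 R \<Longrightarrow> w (x + h) + w (x - h) - 2 * w x \<ge> - m * (norm h)\<^sup>2"
    and m: "0 \<le> m" and R: "0 < R" and cont: "continuous_on (cball x0 R) w"
    and c: "0 < c" and max: "\<And>y. y \<in> cball x0 R \<Longrightarrow> w y \<le> w x0 - c * (norm (y - x0))\<^sup>2"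
    and \<rho>: "0 < \<rho>" and \<delta>: "0 < \<delta>"
  shows "\<not> negligible {x \<in> ball x0 \<rho>. \<exists>p. norm p < \<delta> \<and> (\<forall>y\<in>cball x0 R. w y - p \<bullet> y \<le> w x - p \<bullet> x)}" (is "\<not> negligible ?E")
proof
  assume neg: "negligible ?E"
  \<comment> \<open>contact points within \<open>R / 6\<close> of \<open>x0\<close> leave room for the reflected points in the slope estimate\<close>
  define r where "r = min \<rho> (R / 6)"
  have r: "0 < r" "r \<le> \<rho>" "6 * r \<le> R" using \<rho> R by (auto simp: r_def)
  define \<delta>' where "\<delta>' = min \<delta> (c * r)"
  have \<delta>': "0 < \<delta>'" "\<delta>' \<le> \<delta>" "\<delta>' \<le> c * r" using \<delta> c r by (auto simp: \<delta>'_def)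
  define contact where "contact x p \<longleftrightarrow> (\<forall>y\<in>cball x0 R. w y - p \<bullet> y \<le> w x - p \<bullet> x)" for x p
  define E where "E = {x \<in> ball x0 r. \<exists>p. norm p < \<delta>' \<and> contact x p}"
  have "E \<subseteq> ?E"
  proof
    fix x assume "x \<in> E"
    then obtain p where "x \<in> ball x0 r" "norm p < \<delta>'" "\<forall>y\<in>cball x0 R. w y - p \<bullet> y \<le> w x - p \<bullet> x"
      by (auto simp: E_def contact_def)
    moreover from this have "x \<in> ball x0 \<rho>" "norm p < \<delta>" using r \<delta>' by auto
    ultimately show "x \<in> ?E" by blast
  qed
  then have negE: "negligible E" using neg negligible_subset by blast
  define P where "P x = (SOME p. norm p < \<delta>' \<and> contact x p)" for x
  have P: "norm (P x) < \<delta>' \<and> contact x (P x)" if "x \<in> E" for x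
  proof -
    have "\<exists>p. norm p < \<delta>' \<and> contact x p" using that by (auto simp: E_def)
    then show ?thesis unfolding P_def by (rule someI_ex)
  qed
  have slopes: "norm (p - q) \<le> 4 * m * norm (x - y)" if "x \<in> E" "y \<in> E" "contact x p" "contact y q" for x y p q
    using that by (intro Jensen_contact_slopes_Lipschitz[OF semi m r(1) r(3)]) (auto simp: E_def contact_def)
  have "negligible (P ` E)"
  proof (rule negligible_locally_Lipschitz_image[OF _ negE])
    fix x assume "x \<in> E"
    then show "\<exists>T B. open T \<and> x \<in> T \<and> (\<forall>y\<in>E \<inter> T. norm (P y - P x) \<le> B * norm (y - x))"
      using slopes P by (intro exI[of _ UNIV] exI[of _ "4 * m"]) auto
  qed simp
  moreover have "ball 0 \<delta>' \<subseteq> P ` E"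
  proof
    fix p :: 'a assume "p \<in> ball 0 \<delta>'"
    then have p: "norm p < \<delta>'" by simp
    have "\<exists>x\<in>cball x0 R. \<forall>y\<in>cball x0 R. w y - p \<bullet> y \<le> w x - p \<bullet> x"
      using R by (intro continuous_attains_sup continuous_intros cont) auto
    then obtain x where x: "x \<in> cball x0 R" "contact x p" by (auto simp: contact_def)
    have "w x0 - p \<bullet> x0 \<le> w x - p \<bullet> x" using x(2) R by (auto simp: contact_def)
    then have "c * (norm (x - x0))\<^sup>2 \<le> (- p) \<bullet> (x - x0)" using max[OF x(1)] by (simp add: inner_diff_right)
    also have "\<dots> \<le> norm p * norm (x - x0)" using norm_cauchy_schwarz[of "- p" "x - x0"] by simp
    finally have le: "c * (norm (x - x0))\<^sup>2 \<le> norm p * norm (x - x0)" .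
    have "norm (x - x0) < r"
    proof (cases "x = x0")
      case True then show ?thesis using r by simp
    next
      case False
      then have "c * norm (x - x0) \<le> norm p" using le by (simp add: power2_eq_square mult.assoc[symmetric])
      also have "\<dots> < c * r" using p \<delta>' by linarith
      finally show ?thesis using c by simp
    qed
    then have "x \<in> E" using p x by (auto simp: E_def dist_norm norm_minus_commute)
    moreover have "P x = p" using slopes[OF \<open>x \<in> E\<close> \<open>x \<in> E\<close> _ x(2), of "P x"] P[OF \<open>x \<in> E\<close>] by simp
    ultimately show "p \<in> P ` E" by blast
  qed
  ultimately have "negligible (ball (0::'a) \<delta>')" using negligible_subset by blast
  then show False using open_not_negligible[of "ball (0::'a) \<delta>'"] \<delta>' by simp
qed

section \<open>Jets and quadratic test functions\<close>

text \<open>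
  Jets carry symmetric matrices, whereas an expansion only comes with some linear map; symmetrising the
  map does not change its quadratic form.
\<close>

lemma symmetric_matrix_of_quadratic_form:
  fixes L :: "real^'n \<Rightarrow> real^'n"
  assumes "linear L"
  shows "\<exists>A. transpose A = A \<and> (\<forall>h. (A *v h) \<bullet> h = L h \<bullet> h)"
proof (intro exI conjI allI)
  let ?M = "matrix L"
  let ?A = "(1/2) *\<^sub>R (?M + transpose ?M)"
  show "transpose ?A = ?A"
    by (simp add: transpose_def vec_eq_iff add.commute)
  fix h
  have "(transpose ?M *v h) \<bullet> h = (?M *v h) \<bullet> h"
    by (metis dot_lmul_matrix inner_commute transpose_matrix_vector)
  then have "(?A *v h) \<bullet> h = (?M *v h) \<bullet> h"
    by (simp add: scaleR_matrix_vector_assoc[symmetric] matrix_vector_mult_add_rdistrib inner_add_left)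
  then show "(?A *v h) \<bullet> h = L h \<bullet> h" using assms by (simp add: matrix_works)
qed

lemma symmetric_matrix_inner:
  fixes A :: "real^'n^'n"
  shows "transpose A = A \<Longrightarrow> (A *v h) \<bullet> k = (A *v k) \<bullet> h"
  by (metis dot_lmul_matrix inner_commute transpose_matrix_vector)

lemma mat_scaleR: "mat c *v h = c *\<^sub>R (h :: real^'n)"
  by (simp add: matrix_vector_mult_def mat_def vec_eq_iff if_distrib[where f="\<lambda>x. x * _"] sum.delta cong: if_cong)

lemma gradient_eqI:
  fixes \<phi> :: "real^'n \<Rightarrow> real"
  assumes "(\<phi> has_derivative (\<lambda>h. g \<bullet> h)) (at x)"
  shows "gradient \<phi> x = g"
  unfolding gradient_def frechet_derivative_at[OF assms, symmetric]
  by (simp add: vec_eq_iff inner_axis)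

lemma has_derivative_gradient:
  fixes \<phi> :: "real^'n \<Rightarrow> real"
  assumes "\<phi> differentiable (at x)"
  shows "(\<phi> has_derivative (\<lambda>h. gradient \<phi> x \<bullet> h)) (at x)"
proof -
  let ?D = "frechet_derivative \<phi> (at x)"
  have D: "(\<phi> has_derivative ?D) (at x)" using assms by (simp add: frechet_derivative_works)
  interpret bounded_linear ?D using D by (rule has_derivative_bounded_linear)
  have "?D h = gradient \<phi> x \<bullet> h" for h
  proof -
    have "?D h = ?D (\<Sum>i\<in>UNIV. h $ i *\<^sub>R axis i 1)"
      unfolding scalar_mult_eq_scaleR[symmetric] basis_expansion by (rule refl)
    also have "\<dots> = gradient \<phi> x \<bullet> h" by (simp add: sum scaleR gradient_def inner_vec_def mult.commute)
    finally show ?thesis .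
  qed
  then have "?D = (\<lambda>h. gradient \<phi> x \<bullet> h)" by blast
  with D show ?thesis by simp
qed

lemma has_derivative_quadratic:
  fixes A :: "real^'n^'n"
  assumes A: "transpose A = A"
  shows "((\<lambda>y. c + p \<bullet> (y - x) + (A *v (y - x)) \<bullet> (y - x) / 2) has_derivative (\<lambda>h. (p + A *v (y - x)) \<bullet> h)) (at y)"
proof -
  interpret bounded_linear "(*v) A" by (rule matrix_vector_mul_bounded_linear)
  have "((\<lambda>y. A *v (y - x)) has_derivative (\<lambda>h. A *v h)) (at y)"
    by (auto intro!: derivative_eq_intros has_derivative)
  then have "((\<lambda>y. c + p \<bullet> (y - x) + (A *v (y - x)) \<bullet> (y - x) / 2) has_derivative
      (\<lambda>h. p \<bullet> h + ((A *v (y - x)) \<bullet> h + (A *v h) \<bullet> (y - x)) / 2)) (at y)"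
    by (auto intro!: derivative_eq_intros)
  moreover have "p \<bullet> h + ((A *v (y - x)) \<bullet> h + (A *v h) \<bullet> (y - x)) / 2 = (p + A *v (y - x)) \<bullet> h" for h
    using symmetric_matrix_inner[OF A, of h "y - x"] by (simp add: inner_add_left)
  ultimately show ?thesis by simp
qed

lemma
  fixes A :: "real^'n^'n" and c :: real and p x :: "real^'n"
  assumes A: "transpose A = A"
  defines "\<phi> \<equiv> (\<lambda>y. c + p \<bullet> (y - x) + (A *v (y - x)) \<bullet> (y - x) / 2)"
  shows gradient_quadratic: "gradient \<phi> y = p + A *v (y - x)"
    and hessian_quadratic: "hessian \<phi> y = A"
    and C2_near_quadratic: "C2_near \<phi> z"
proof -
  have der: "(\<phi> has_derivative (\<lambda>h. (p + A *v (y - x)) \<bullet> h)) (at y)" for y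
    unfolding \<phi>_def by (rule has_derivative_quadratic[OF A])
  show g: "gradient \<phi> y = p + A *v (y - x)" for y by (rule gradient_eqI[OF der])
  interpret bounded_linear "(*v) A" by (rule matrix_vector_mul_bounded_linear)
  have "((\<lambda>y. p + A *v (y - x)) has_derivative (\<lambda>h. A *v h)) (at y)" for y
    by (auto intro!: derivative_eq_intros has_derivative)
  moreover have "gradient \<phi> = (\<lambda>y. p + A *v (y - x))" using g by blast
  ultimately have dg: "(gradient \<phi> has_derivative (\<lambda>h. A *v h)) (at y)" for y by simp
  show H: "hessian \<phi> y = A" for y
    unfolding hessian_def jacobian_def frechet_derivative_at[OF dg, symmetric]
    by (rule matrix_of_matrix_vector_mul)
  have "\<phi> differentiable_on UNIV" "gradient \<phi> differentiable_on UNIV"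
    using der dg by (auto simp: differentiable_on_def differentiable_def)
  moreover have "hessian \<phi> = (\<lambda>y. A)" using H by blast
  ultimately show "C2_near \<phi> z" unfolding C2_near_def by (intro exI[of _ UNIV]) auto
qed

text \<open>
  The quadratic with Hessian \<open>A + \<eta> I\<close> lies above \<open>u\<close> near \<open>x\<close> because the extra term
  \<open>\<eta> |y - x|\<^sup>2 / 2\<close> dominates the remainder of the expansion.
\<close>

lemma subharmonic_second_order_jet:
  fixes u :: "real^'n \<Rightarrow> real" and A :: "real^'n^'n"
  assumes u: "(\<lambda>x. ereal (u x)) \<in> subharmonics F X" and x: "x \<in> X"
    and exp: "second_order_expansion u x p L" and A: "transpose A = A" "\<And>h. (A *v h) \<bullet> h = L h \<bullet> h"
    and \<eta>: "0 < \<eta>"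
  shows "(u x, p, A + mat \<eta>) \<in> fiber F x"
proof -
  define \<phi> where "\<phi> y = u x + p \<bullet> (y - x) + ((A + mat \<eta>) *v (y - x)) \<bullet> (y - x) / 2" for y
  have sym: "transpose (A + mat \<eta>) = A + mat \<eta>"
    using A(1) by (simp add: transpose_def vec_eq_iff mat_def)
  have "\<phi> = (\<lambda>y. u x + p \<bullet> (y - x) + ((A + mat \<eta>) *v (y - x)) \<bullet> (y - x) / 2)" using \<phi>_def by blast
  then have C2: "C2_near \<phi> x" and gr: "gradient \<phi> x = p" and he: "hessian \<phi> x = A + mat \<eta>"
    using C2_near_quadratic[OF sym] gradient_quadratic[OF sym] hessian_quadratic[OF sym] by simp_all
  obtain d where d: "d > 0" "\<And>h. norm h < d \<Longrightarrow> \<bar>u (x + h) - u x - p \<bullet> h - L h \<bullet> h / 2\<bar> \<le> \<eta> / 2 * (norm h)\<^sup>2"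
    using exp \<eta> unfolding second_order_expansion_def by (meson half_gt_zero)
  have "u y \<le> \<phi> y" if "y \<in> ball x d" for y
  proof -
    have "norm (y - x) < d" using that by (simp add: dist_norm norm_minus_commute)
    then have "\<bar>u y - u x - p \<bullet> (y - x) - L (y - x) \<bullet> (y - x) / 2\<bar> \<le> \<eta> / 2 * (norm (y - x))\<^sup>2"
      using d(2)[of "y - x"] by simp
    then have "u y \<le> u x + p \<bullet> (y - x) + L (y - x) \<bullet> (y - x) / 2 + \<eta> / 2 * (norm (y - x))\<^sup>2"
      by linarith
    also have "\<dots> = \<phi> y"
      by (simp add: \<phi>_def matrix_vector_mult_add_rdistrib mat_scaleR inner_add_left A(2) power2_norm_eq_inner add_divide_distrib)
    finally show ?thesis .
  qed
  then have "\<forall>\<^sub>F y in nhds x. y \<in> X \<longrightarrow> ereal (u y) - ereal (\<phi> y) \<le> 0"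
    using d(1) unfolding eventually_nhds_metric
    by (intro exI[of _ d]) (auto simp: dist_commute zero_ereal_def)
  moreover have "ereal (u x) - ereal (\<phi> x) = 0" by (simp add: \<phi>_def zero_ereal_def)
  ultimately have "(\<phi> x, gradient \<phi> x, hessian \<phi> x) \<in> fiber F x"
    using u x C2 unfolding subharmonics_def by blast
  then show ?thesis using gr he by (simp add: \<phi>_def)
qed

lemma C2_near_second_order:
  fixes \<phi> :: "real^'n \<Rightarrow> real"
  assumes "C2_near \<phi> x"
  shows "second_order_expansion \<phi> x (gradient \<phi> x) (\<lambda>h. hessian \<phi> x *v h)"
    and "transpose (hessian \<phi> x) = hessian \<phi> x"
proof -
  obtain U where U: "open U" "x \<in> U" "\<phi> differentiable_on U" "gradient \<phi> differentiable_on U"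
    using assms unfolding C2_near_def by blast
  obtain r where r: "r > 0" "ball x r \<subseteq> U" using U(1,2) open_contains_ball by blast
  have f: "(\<phi> has_derivative (\<lambda>h. gradient \<phi> y \<bullet> h)) (at y)" if "y \<in> ball x r" for y
    using U(1,3) r(2) that by (intro has_derivative_gradient) (auto simp: differentiable_on_eq_differentiable_at)
  have "gradient \<phi> differentiable (at x)"
    using U by (auto simp: differentiable_on_eq_differentiable_at)
  then have G: "(gradient \<phi> has_derivative (\<lambda>h. hessian \<phi> x *v h)) (at x)"
    unfolding hessian_def by (simp add: jacobian_works)
  show "second_order_expansion \<phi> x (gradient \<phi> x) (\<lambda>h. hessian \<phi> x *v h)"
    by (rule second_order_Taylor[OF r(1) f G])
  have sym: "(hessian \<phi> x *v h) \<bullet> k = (hessian \<phi> x *v k) \<bullet> h" for h k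
    by (rule second_derivative_symmetric[OF r(1) f G])
  have "hessian \<phi> x $ i $ j = hessian \<phi> x $ j $ i" for i j
    using sym[of "axis j 1" "axis i 1"] by (simp add: inner_axis matrix_vector_mul_component)
  then show "transpose (hessian \<phi> x) = hessian \<phi> x" by (simp add: transpose_def vec_eq_iff)
qed

section \<open>Local structure of semiconvex functions and the addition theorem\<close>

lemma locally_semiconvex_imp_isCont:
  assumes "locally_semiconvex X u" and "x \<in> X"
  shows "isCont u x"
proof -
  obtain c \<rho> \<mu> where *: "x \<in> ball c \<rho>" and conv: "convex_on (ball c \<rho>) (\<lambda>y. u y + \<mu> / 2 * (norm y)\<^sup>2)"
    using assms unfolding locally_semiconvex_def by meson
  have "continuous_on (ball c \<rho>) (\<lambda>y. u y + \<mu> / 2 * (norm y)\<^sup>2)"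
    by (rule convex_on_continuous[OF _ conv]) simp
  then have "continuous_on (ball c \<rho>) (\<lambda>y. (u y + \<mu> / 2 * (norm y)\<^sup>2) - \<mu> / 2 * (norm y)\<^sup>2)"
    by (rule continuous_on_diff) (intro continuous_intros)
  then show ?thesis using * by (simp add: continuous_on_eq_continuous_at)
qed

lemma semiconvex_second_difference:
  fixes u :: "'a::real_inner \<Rightarrow> real"
  assumes conv: "convex_on S (\<lambda>y. u y + \<mu> / 2 * (norm y)\<^sup>2)" and S: "x + h \<in> S" "x - h \<in> S"
  shows "u (x + h) + u (x - h) - 2 * u x \<ge> - \<mu> * (norm h)\<^sup>2"
proof -
  define f where "f y = u y + \<mu> / 2 * (norm y)\<^sup>2" for y
  have "(1 - 1/2) *\<^sub>R (x + h) + (1/2) *\<^sub>R (x - h) = x"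
    by (simp add: algebra_simps flip: scaleR_add_left)
  then have "f x \<le> (1 - 1/2) * f (x + h) + (1/2) * f (x - h)"
    using convex_onD[OF conv, of "1/2" "x + h" "x - h"] S by (simp add: f_def)
  then have "0 \<le> f (x + h) + f (x - h) - 2 * f x" by simp
  also have "\<dots> = u (x + h) + u (x - h) - 2 * u x + \<mu> / 2 * ((norm (x + h))\<^sup>2 + (norm (x - h))\<^sup>2 - 2 * (norm x)\<^sup>2)"
    by (simp add: f_def algebra_simps)
  also have "(norm (x + h))\<^sup>2 + (norm (x - h))\<^sup>2 - 2 * (norm x)\<^sup>2 = 2 * (norm h)\<^sup>2"
    by (simp add: power2_norm_eq_inner inner_add_left inner_add_right inner_diff_left inner_diff_right)
  finally show ?thesis by simp
qed

lemma locally_semiconvex_ball: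
  assumes "locally_semiconvex X u" and "x \<in> X"
  shows "\<exists>r>0. \<exists>\<mu>\<ge>0. \<forall>R<r. convex_on (cball x R) (\<lambda>y. u y + \<mu> / 2 * (norm y)\<^sup>2) \<and> continuous_on (cball x R) u \<and> cball x R \<subseteq> X"
proof -
  obtain c \<rho> \<mu> where x: "x \<in> ball c \<rho>" and sub: "ball c \<rho> \<subseteq> X" and \<mu>: "\<mu> \<ge> 0"
    and conv: "convex_on (ball c \<rho>) (\<lambda>y. u y + \<mu> / 2 * (norm y)\<^sup>2)"
    using assms unfolding locally_semiconvex_def by meson
  obtain r where r: "r > 0" "cball x r \<subseteq> ball c \<rho>" using x open_contains_cball[of "ball c \<rho>"] open_ball by blast
  have "convex_on (cball x R) (\<lambda>y. u y + \<mu> / 2 * (norm y)\<^sup>2) \<and> continuous_on (cball x R) u \<and> cball x R \<subseteq> X" if "R < r" for R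
  proof -
    have R: "cball x R \<subseteq> ball c \<rho>" using r that subset_cball[of R r x] by force
    have "convex_on (cball x R) (\<lambda>y. u y + \<mu> / 2 * (norm y)\<^sup>2)" by (rule convex_on_subset[OF conv R]) simp
    moreover have "continuous_on (cball x R) u"
      using locally_semiconvex_imp_isCont[OF assms(1)] R sub
      by (intro continuous_at_imp_continuous_on ballI) blast
    ultimately show ?thesis using R sub by blast
  qed
  then show ?thesis using r \<mu> by blast
qed

text \<open>
  The maximum condition gives \<open>Du + Dv = a\<close> and makes \<open>P = Q - D\<^sup>2u - D\<^sup>2v + \<eta> I\<close> positive
  definite. Adding \<open>P\<close> to the Hessian of the jet of \<open>v\<close> turns the sum of the Hessians into
  \<open>Q + 3 \<eta> I\<close>, whatever \<open>D\<^sup>2u\<close> and \<open>D\<^sup>2v\<close> are.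
\<close>

lemma semiconvex_sum_jet:
  fixes u v :: "real^'n \<Rightarrow> real" and Q :: "real^'n^'n"
  assumes prim: "primitive_subequation X G"
    and sub: "(\<lambda>x. ereal (u x)) \<in> subharmonics F X" "(\<lambda>x. ereal (v x)) \<in> subharmonics G X"
    and x: "x \<in> X"
    and expu: "linear Lu" "second_order_expansion u x pu Lu"
    and expv: "linear Lv" "second_order_expansion v x pv Lv"
    and Q: "transpose Q = Q" and \<eta>: "0 < \<eta>"
    and d: "0 < d" and max: "\<And>h. norm h < d \<Longrightarrow> u (x + h) + v (x + h) \<le> u x + v x + a \<bullet> h + (Q *v h) \<bullet> h / 2"
  shows "(x, (u x + v x, a, Q + 3 *\<^sub>R mat \<eta>)) \<in> fiberwise_sum F G"
proof -
  have linQ: "linear (\<lambda>h. - (Q *v h))" by (intro linear_compose_neg matrix_vector_mul_linear)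
  have "second_order_expansion (\<lambda>y. - (u x + v x) + (- a) \<bullet> (y - x) + (- (Q *v (y - x))) \<bullet> (y - x) / 2) x
      ((- a) + - (Q *v (x - x))) (\<lambda>h. - (Q *v h))"
    by (rule second_order_expansion_quadratic[OF linQ]) (use symmetric_matrix_inner[OF Q] in simp)
  from second_order_expansion_add[OF second_order_expansion_add[OF expu(2) expv(2)] this]
  have exp: "second_order_expansion (\<lambda>y. u y + v y + (- (u x + v x) + (- a) \<bullet> (y - x) + (- (Q *v (y - x))) \<bullet> (y - x) / 2)) x
     (pu + pv - a) (\<lambda>h. Lu h + Lv h - Q *v h)" by simp
  have lin: "linear (\<lambda>h. Lu h + Lv h - Q *v h)"
    by (intro linear_compose_add linear_compose_sub expu expv matrix_vector_mul_linear)
  have mx: "u (x + h) + v (x + h) + (- (u x + v x) + (- a) \<bullet> (x + h - x) + (- (Q *v (x + h - x))) \<bullet> (x + h - x) / 2)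
     \<le> u x + v x + (- (u x + v x) + (- a) \<bullet> (x - x) + (- (Q *v (x - x))) \<bullet> (x - x) / 2)" if "norm h < d" for h
    using max[OF that] by simp
  have "pu + pv - a = 0" by (rule second_order_expansion_local_max(1)[OF exp lin d mx])
  then have p: "pu + pv = a" by simp
  have le: "(Lu k + Lv k - Q *v k) \<bullet> k \<le> 0" for k by (rule second_order_expansion_local_max(2)[OF exp lin d mx])
  obtain A where A: "transpose A = A" "\<And>h. (A *v h) \<bullet> h = Lu h \<bullet> h"
    using symmetric_matrix_of_quadratic_form[OF expu(1)] by blast
  obtain B where B: "transpose B = B" "\<And>h. (B *v h) \<bullet> h = Lv h \<bullet> h"
    using symmetric_matrix_of_quadratic_form[OF expv(1)] by blast
  have mat: "mat \<eta> *v h = \<eta> *\<^sub>R h" for h :: "real^'n" by (rule mat_scaleR)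
  define P where "P = Q - A - B + mat \<eta>"
  have P: "P \<in> sym_matrices" using A B Q by (simp add: P_def sym_matrices_def transpose_def vec_eq_iff mat_def)
  have "loewner_less 0 P" unfolding loewner_less_def
  proof (intro allI impI)
    fix k :: "real^'n" assume "k \<noteq> 0"
    have AB: "k \<bullet> (A *v k) = k \<bullet> Lu k" "k \<bullet> (B *v k) = k \<bullet> Lv k"
      using A(2)[of k] B(2)[of k] by (simp_all add: inner_commute)
    have "k \<bullet> (P *v k) = - ((Lu k + Lv k - Q *v k) \<bullet> k) + \<eta> * (k \<bullet> k)"
      by (simp add: P_def matrix_vector_mult_add_rdistrib matrix_vector_mult_diff_rdistrib mat inner_add_right inner_diff_right inner_diff_left inner_add_left inner_commute AB)
    moreover have "\<eta> * (k \<bullet> k) > 0" using \<eta> \<open>k \<noteq> 0\<close> by simp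
    ultimately show "k \<bullet> (0 *v k) < k \<bullet> (P *v k)" using le[of k] by simp
  qed
  have "(u x, pu, A + mat \<eta>) \<in> fiber F x" by (rule subharmonic_second_order_jet[OF sub(1) x expu(2) A \<eta>])
  moreover have "(v x, pv, B + mat \<eta>) \<in> fiber G x" by (rule subharmonic_second_order_jet[OF sub(2) x expv(2) B \<eta>])
  then have "(v x, pv, B + mat \<eta> + P) \<in> fiber G x"
    using prim x P \<open>loewner_less 0 P\<close> unfolding primitive_subequation_def by blast
  ultimately have "(x, (u x, pu, A + mat \<eta>) + (v x, pv, B + mat \<eta> + P)) \<in> fiberwise_sum F G"
    unfolding fiberwise_sum_def by blast
  moreover have "(u x, pu, A + mat \<eta>) + (v x, pv, B + mat \<eta> + P) = (u x + v x, a, Q + 3 *\<^sub>R mat \<eta>)"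
  proof -
    have "3 *\<^sub>R mat \<eta> = mat \<eta> + mat \<eta> + (mat \<eta> :: real^'n^'n)" by (simp add: vec_eq_iff)
    then show ?thesis using p by (simp add: P_def)
  qed
  ultimately show ?thesis by simp
qed

text \<open>
  Here \<open>q\<close> is the Taylor polynomial of the test function with Hessian enlarged by \<open>\<eta> I\<close>. The
  contact set of \<open>u + v - q\<close> near \<open>x0\<close> is not null, so it contains a point outside the exceptional
  null sets of \<open>u\<close> and \<open>v\<close>.
\<close>

lemma nearby_sum_jet:
  fixes u v \<phi> :: "real^'n \<Rightarrow> real"
  assumes prim: "primitive_subequation X G"
    and sub: "(\<lambda>x. ereal (u x)) \<in> subharmonics F X" "(\<lambda>x. ereal (v x)) \<in> subharmonics G X"
    and semi: "locally_semiconvex X u" "locally_semiconvex X v" and x0: "x0 \<in> X"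
    and C2: "C2_near \<phi> x0" and touch: "u x0 + v x0 = \<phi> x0"
    and above: "\<forall>\<^sub>F y in nhds x0. y \<in> X \<longrightarrow> u y + v y \<le> \<phi> y"
    and \<eta>: "0 < \<eta>"
  shows "\<exists>x p. norm (x - x0) < \<eta> \<and> norm p < \<eta> \<and>
    (x, (u x + v x, gradient \<phi> x0 + (hessian \<phi> x0 + mat \<eta>) *v (x - x0) + p, hessian \<phi> x0 + mat \<eta> + 3 *\<^sub>R mat \<eta>)) \<in> fiberwise_sum F G"
proof -
  define g where "g = gradient \<phi> x0"
  define H where "H = hessian \<phi> x0"
  define Q where "Q = H + mat \<eta>"
  have H: "transpose H = H" and exp\<phi>: "second_order_expansion \<phi> x0 g (\<lambda>h. H *v h)"
    using C2_near_second_order[OF C2] by (simp_all add: H_def g_def)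
  have Q: "transpose Q = Q" using H by (simp add: Q_def transpose_def vec_eq_iff mat_def)
  obtain d1 where d1: "d1 > 0" "\<And>h. norm h < d1 \<Longrightarrow> \<bar>\<phi> (x0 + h) - \<phi> x0 - g \<bullet> h - (H *v h) \<bullet> h / 2\<bar> \<le> \<eta> / 4 * (norm h)\<^sup>2"
    using exp\<phi> \<eta> unfolding second_order_expansion_def by (meson divide_pos_pos zero_less_numeral)
  obtain d2 where d2: "d2 > 0" "\<And>y. dist y x0 < d2 \<Longrightarrow> y \<in> X \<Longrightarrow> u y + v y \<le> \<phi> y"
    using above unfolding eventually_nhds_metric by blast
  obtain ru \<mu>u where u: "ru > 0" "\<mu>u \<ge> 0" "\<And>R. R < ru \<Longrightarrow> convex_on (cball x0 R) (\<lambda>y. u y + \<mu>u / 2 * (norm y)\<^sup>2) \<and> continuous_on (cball x0 R) u \<and> cball x0 R \<subseteq> X"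
    using locally_semiconvex_ball[OF semi(1) x0] by blast
  obtain rv \<mu>v where v: "rv > 0" "\<mu>v \<ge> 0" "\<And>R. R < rv \<Longrightarrow> convex_on (cball x0 R) (\<lambda>y. v y + \<mu>v / 2 * (norm y)\<^sup>2) \<and> continuous_on (cball x0 R) v \<and> cball x0 R \<subseteq> X"
    using locally_semiconvex_ball[OF semi(2) x0] by blast
  define R where "R = min (min d1 d2) (min ru rv) / 2"
  have R: "0 < R" "R < d1" "R < d2" "R < ru" "R < rv" using d1 d2 u(1) v(1) by (auto simp: R_def)
  have convu: "convex_on (cball x0 R) (\<lambda>y. u y + \<mu>u / 2 * (norm y)\<^sup>2)" and contu: "continuous_on (cball x0 R) u" and RX: "cball x0 R \<subseteq> X"
    using u(3)[OF R(4)] by auto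
  have convv: "convex_on (cball x0 R) (\<lambda>y. v y + \<mu>v / 2 * (norm y)\<^sup>2)" and contv: "continuous_on (cball x0 R) v"
    using v(3)[OF R(5)] by auto
  obtain Nu where Nu: "negligible Nu" "\<And>x C d. x \<in> ball x0 R - Nu \<Longrightarrow> 0 < d \<Longrightarrow>
     (\<forall>h. norm h < d \<longrightarrow> u (x + h) + u (x - h) - 2 * u x \<le> C * (norm h)\<^sup>2) \<Longrightarrow>
     (\<exists>p A. linear A \<and> second_order_expansion u x p A)"
    using semiconvex_second_order_expansion_off_null_set[OF convu contu R(1)] by metis
  obtain Nv where Nv: "negligible Nv" "\<And>x C d. x \<in> ball x0 R - Nv \<Longrightarrow> 0 < d \<Longrightarrow>
     (\<forall>h. norm h < d \<longrightarrow> v (x + h) + v (x - h) - 2 * v x \<le> C * (norm h)\<^sup>2) \<Longrightarrow>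
     (\<exists>p A. linear A \<and> second_order_expansion v x p A)"
    using semiconvex_second_order_expansion_off_null_set[OF convv contv R(1)] by metis
  define q where "q y = g \<bullet> (y - x0) + (Q *v (y - x0)) \<bullet> (y - x0) / 2" for y
  define w where "w y = u y + v y - q y" for y
  have q_shift: "q (x + h) = q x + (g + Q *v (x - x0)) \<bullet> h + (Q *v h) \<bullet> h / 2" for x h
  proof -
    have "Q *v (x + h - x0) = Q *v (x - x0) + Q *v h" 
      by (metis add.commute add_diff_eq matrix_vector_right_distrib)
    then show ?thesis using symmetric_matrix_inner[OF Q, of h "x - x0"]
      by (simp add: q_def inner_add_left inner_add_right inner_diff_right field_simps)
  qed
  obtain B where B: "B > 0" "\<And>h. norm (Q *v h) \<le> B * norm h"
    using linear_bounded_pos[OF matrix_vector_mul_linear[of Q]] by blast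
  have Qh: "\<bar>(Q *v h) \<bullet> h\<bar> \<le> B * (norm h)\<^sup>2" for h
  proof -
    have "\<bar>(Q *v h) \<bullet> h\<bar> \<le> norm (Q *v h) * norm h" by (rule Cauchy_Schwarz_ineq2)
    also have "\<dots> \<le> B * norm h * norm h" using B by (intro mult_right_mono) auto
    finally show ?thesis by (simp add: power2_eq_square mult.assoc)
  qed
  have q2: "q (x + h) + q (x - h) - 2 * q x = (Q *v h) \<bullet> h" for x h
    using q_shift[of x h] q_shift[of x "- h"] by (simp add: linear_neg[OF matrix_vector_mul_linear])
  have semiu: "u (x + h) + u (x - h) - 2 * u x \<ge> - \<mu>u * (norm h)\<^sup>2" if "x + h \<in> cball x0 R" "x - h \<in> cball x0 R" for x h
    by (rule semiconvex_second_difference[OF convu that])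
  have semiv: "v (x + h) + v (x - h) - 2 * v x \<ge> - \<mu>v * (norm h)\<^sup>2" if "x + h \<in> cball x0 R" "x - h \<in> cball x0 R" for x h
    by (rule semiconvex_second_difference[OF convv that])
  define E where "E = {x \<in> ball x0 (min \<eta> R). \<exists>p. norm p < \<eta> \<and> (\<forall>y\<in>cball x0 R. w y - p \<bullet> y \<le> w x - p \<bullet> x)}"
  have "\<not> negligible E" unfolding E_def
  proof (rule Jensen_contact_set_not_negligible[where m = "\<mu>u + \<mu>v + B" and c = "\<eta> / 4"])
    fix x h assume "x + h \<in> ball x0 R" "x - h \<in> ball x0 R"
    then have m: "x + h \<in> cball x0 R" "x - h \<in> cball x0 R" by auto
    have "w (x + h) + w (x - h) - 2 * w x = (u (x + h) + u (x - h) - 2 * u x) + (v (x + h) + v (x - h) - 2 * v x) - (Q *v h) \<bullet> h"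
      using q2[of x h] by (simp add: w_def algebra_simps)
    moreover have "(Q *v h) \<bullet> h \<le> B * (norm h)\<^sup>2" using Qh[of h] by linarith
    ultimately show "w (x + h) + w (x - h) - 2 * w x \<ge> - (\<mu>u + \<mu>v + B) * (norm h)\<^sup>2"
      using semiu[OF m] semiv[OF m] by (simp add: algebra_simps)
  next
    show "continuous_on (cball x0 R) w" unfolding w_def q_def
      by (intro continuous_intros contu contv linear_continuous_on_compose[OF _ matrix_vector_mul_linear[of Q]]) auto
  next
    fix y assume y: "y \<in> cball x0 R"
    then have n: "norm (y - x0) \<le> R" by (simp add: dist_norm norm_minus_commute)
    have "u y + v y \<le> \<phi> y" using d2(2)[of y] y R RX by (auto simp: dist_commute)
    also have "\<phi> y \<le> \<phi> x0 + g \<bullet> (y - x0) + (H *v (y - x0)) \<bullet> (y - x0) / 2 + \<eta> / 4 * (norm (y - x0))\<^sup>2"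
    proof -
      have "x0 + (y - x0) = y" "norm (y - x0) < d1" using n R by auto
      then have "\<bar>\<phi> y - \<phi> x0 - g \<bullet> (y - x0) - (H *v (y - x0)) \<bullet> (y - x0) / 2\<bar> \<le> \<eta> / 4 * (norm (y - x0))\<^sup>2"
        using d1(2)[of "y - x0"] by metis
      then show ?thesis by linarith
    qed
    also have "\<dots> = \<phi> x0 + q y - \<eta> / 4 * (norm (y - x0))\<^sup>2"
      by (simp add: q_def Q_def matrix_vector_mult_add_rdistrib mat_scaleR inner_add_left power2_norm_eq_inner add_divide_distrib)
    finally show "w y \<le> w x0 - \<eta> / 4 * (norm (y - x0))\<^sup>2"
      using touch by (simp add: w_def q_def)
  qed (use u(2) v(2) B R \<eta> in auto)
  then have "\<not> E \<subseteq> Nu \<union> Nv" using negligible_Un[OF Nu(1) Nv(1)] negligible_subset by blast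
  then obtain x where x: "x \<in> E" "x \<notin> Nu" "x \<notin> Nv" by blast
  then obtain p where p: "norm p < \<eta>" and ct: "\<And>y. y \<in> cball x0 R \<Longrightarrow> w y - p \<bullet> y \<le> w x - p \<bullet> x"
    and xb: "x \<in> ball x0 R" "norm (x - x0) < \<eta>"
    unfolding E_def by (auto simp: dist_norm norm_minus_commute)
  define d where "d = R - norm (x - x0)"
  have d: "0 < d" using xb by (simp add: d_def dist_norm norm_minus_commute)
  have mem: "x + h \<in> cball x0 R" "x - h \<in> cball x0 R" if "norm h < d" for h
    using norm_triangle_ineq[of "x - x0" h] norm_triangle_ineq4[of "x - x0" h] that
    by (auto simp: d_def dist_norm norm_minus_commute algebra_simps)
  have w2: "w (x + h) + w (x - h) - 2 * w x \<le> 0" if "norm h < d" for h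
    using ct[OF mem(1)[OF that]] ct[OF mem(2)[OF that]] by (simp add: inner_add_right inner_diff_right)
  have uv2: "(u (x + h) + u (x - h) - 2 * u x) + (v (x + h) + v (x - h) - 2 * v x) \<le> B * (norm h)\<^sup>2" if "norm h < d" for h
    using w2[OF that] q2[of x h] Qh[of h] by (simp add: w_def)
  have "u (x + h) + u (x - h) - 2 * u x \<le> (B + \<mu>v) * (norm h)\<^sup>2" if "norm h < d" for h
    using uv2[OF that] semiv[OF mem[OF that]] by (simp add: distrib_right)
  then obtain pu Lu where Lu: "linear Lu" "second_order_expansion u x pu Lu"
    using Nu(2)[of x d "B + \<mu>v"] x xb d by blast
  have "v (x + h) + v (x - h) - 2 * v x \<le> (B + \<mu>u) * (norm h)\<^sup>2" if "norm h < d" for h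
    using uv2[OF that] semiu[OF mem[OF that]] by (simp add: distrib_right)
  then obtain pv Lv where Lv: "linear Lv" "second_order_expansion v x pv Lv"
    using Nv(2)[of x d "B + \<mu>u"] x xb d by blast
  have "(x, (u x + v x, g + Q *v (x - x0) + p, Q + 3 *\<^sub>R mat \<eta>)) \<in> fiberwise_sum F G"
  proof (rule semiconvex_sum_jet[OF prim sub _ Lu Lv Q \<eta> d])
    show "x \<in> X" using xb RX by auto
    fix h :: "real^'n" assume "norm h < d"
    then show "u (x + h) + v (x + h) \<le> u x + v x + (g + Q *v (x - x0) + p) \<bullet> h + (Q *v h) \<bullet> h / 2"
      using ct[OF mem(1), of h] q_shift[of x h] by (simp add: w_def inner_add_left inner_add_right)
  qed
  then show ?thesis using xb p by (auto simp: Q_def H_def g_def)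
qed

theorem theorem8p3:
  fixes X :: "(real^'n) set"
    and F G K :: "((real^'n) \<times> 'n jet) set"
    and u v :: "real^'n \<Rightarrow> real"
  assumes "open X"
    and "primitive_subequation X F"
    and "primitive_subequation X G"
    and "K = top_of_set (J2_over X) closure_of (fiberwise_sum F G)"
    and "(\<lambda>x. ereal (u x)) \<in> subharmonics F X"
    and "(\<lambda>x. ereal (v x)) \<in> subharmonics G X"
    and "locally_semiconvex X u"
    and "locally_semiconvex X v"
  shows "(\<lambda>x. ereal (u x + v x)) \<in> subharmonics K X"
proof -
  have contw: "isCont (\<lambda>x. u x + v x) x" if "x \<in> X" for x
    by (intro continuous_intros locally_semiconvex_imp_isCont[OF _ that] assms)
  have usc: "usc_on X (\<lambda>x. ereal (u x + v x))"
    unfolding usc_on_def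
  proof
    fix c :: ereal
    have "open (X \<inter> (\<lambda>x. u x + v x) -` {r. ereal r < c})"
    proof (rule continuous_open_preimage)
      show "continuous_on X (\<lambda>x. u x + v x)" using contw by (simp add: continuous_at_imp_continuous_on)
      have "{r. ereal r < c} = ereal -` {..<c}" by auto
      then show "open {r. ereal r < c}" by (simp add: open_ereal_vimage)
    qed (rule assms)
    moreover have "X \<inter> (\<lambda>x. u x + v x) -` {r. ereal r < c} = {x \<in> X. ereal (u x + v x) < c}" by auto
    ultimately show "openin (top_of_set X) {x \<in> X. ereal (u x + v x) < c}"
      using assms(1) by (simp add: openin_open_eq)
  qed
  have FJ: "F \<subseteq> J2_over X" and GJ: "G \<subseteq> J2_over X"
    using assms(2,3)[unfolded primitive_subequation_def, THEN conjunct1, THEN closedin_subset] by simp_all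
  have sumJ: "fiberwise_sum F G \<subseteq> J2_over X"
  proof
    fix j assume "j \<in> fiberwise_sum F G"
    then obtain x J J' where j: "j = (x, J + J')" "(x, J) \<in> F" "(x, J') \<in> G"
      by (auto simp: fiberwise_sum_def fiber_def)
    then have "(x, J) \<in> J2_over X" "(x, J') \<in> J2_over X" using FJ GJ by auto
    then show "j \<in> J2_over X"
      by (auto simp: j(1) J2_over_def J2_def sym_matrices_def transpose_def vec_eq_iff mem_Times_iff)
  qed
  have "(\<phi> x0, gradient \<phi> x0, hessian \<phi> x0) \<in> fiber K x0"
    if x0: "x0 \<in> X" and C2: "C2_near \<phi> x0"
      and above: "\<forall>\<^sub>F y in nhds x0. y \<in> X \<longrightarrow> ereal (u y + v y) - ereal (\<phi> y) \<le> 0"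
      and touch: "ereal (u x0 + v x0) - ereal (\<phi> x0) = 0" for x0 \<phi>
  proof -
    have touch': "u x0 + v x0 = \<phi> x0" using touch by (simp add: zero_ereal_def)
    have above': "\<forall>\<^sub>F y in nhds x0. y \<in> X \<longrightarrow> u y + v y \<le> \<phi> y"
      using above by eventually_elim (simp add: zero_ereal_def)
    define \<eta> where "\<eta> n = inverse (real (Suc n))" for n
    have \<eta>: "\<eta> n > 0" for n by (simp add: \<eta>_def)
    have \<eta>0: "\<eta> \<longlonglongrightarrow> 0" unfolding \<eta>_def by (rule LIMSEQ_inverse_real_of_nat)
    obtain x p where xp: "\<And>n. norm (x n - x0) < \<eta> n" "\<And>n. norm (p n) < \<eta> n"
      "\<And>n. (x n, (u (x n) + v (x n), gradient \<phi> x0 + (hessian \<phi> x0 + mat (\<eta> n)) *v (x n - x0) + p n,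
          hessian \<phi> x0 + mat (\<eta> n) + 3 *\<^sub>R mat (\<eta> n))) \<in> fiberwise_sum F G"
      using nearby_sum_jet[OF assms(3,5,6,7,8) x0 C2 touch' above' \<eta>] by metis
    define j where "j n = (x n, (u (x n) + v (x n), gradient \<phi> x0 + (hessian \<phi> x0 + mat (\<eta> n)) *v (x n - x0) + p n,
          hessian \<phi> x0 + mat (\<eta> n) + 3 *\<^sub>R mat (\<eta> n)))" for n
    have "(\<lambda>n. x n - x0) \<longlonglongrightarrow> 0"
      by (rule Lim_null_comparison[OF _ \<eta>0]) (intro always_eventually allI less_imp_le xp(1))
    then have x_lim: "x \<longlonglongrightarrow> x0" by (simp add: LIM_zero_iff)
    have p_lim: "p \<longlonglongrightarrow> 0"
      by (rule Lim_null_comparison[OF _ \<eta>0]) (intro always_eventually allI less_imp_le xp(2))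
    have w_lim: "(\<lambda>n. u (x n) + v (x n)) \<longlonglongrightarrow> \<phi> x0"
      using isCont_tendsto_compose[OF contw[OF x0] x_lim] touch' by simp
    have mat_lim: "(\<lambda>n. mat (\<eta> n) :: real^'n^'n) \<longlonglongrightarrow> 0"
    proof (intro vec_tendstoI)
      fix i k
      show "(\<lambda>n. (mat (\<eta> n) :: real^'n^'n) $ i $ k) \<longlonglongrightarrow> 0 $ i $ k"
        using \<eta>0 by (cases "i = k") (simp_all add: mat_def)
    qed
    have Hx_lim: "(\<lambda>n. (hessian \<phi> x0 + mat (\<eta> n)) *v (x n - x0)) \<longlonglongrightarrow> 0"
    proof -
      have "(\<lambda>n. hessian \<phi> x0 *v (x n - x0) + \<eta> n *\<^sub>R (x n - x0)) \<longlonglongrightarrow> hessian \<phi> x0 *v 0 + 0 *\<^sub>R 0"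
        using \<open>(\<lambda>n. x n - x0) \<longlonglongrightarrow> 0\<close> \<eta>0
        by (intro tendsto_add tendsto_scaleR bounded_linear.tendsto[OF matrix_vector_mul_bounded_linear])
      then show ?thesis by (simp add: matrix_vector_mult_add_rdistrib mat_scaleR)
    qed
    have "j \<longlonglongrightarrow> (x0, (\<phi> x0, gradient \<phi> x0 + 0 + 0, hessian \<phi> x0 + 0 + 3 *\<^sub>R 0))"
      unfolding j_def by (intro tendsto_intros x_lim w_lim Hx_lim p_lim mat_lim)
    then have j_lim: "j \<longlonglongrightarrow> (x0, (\<phi> x0, gradient \<phi> x0, hessian \<phi> x0))" by simp
    have target: "(x0, (\<phi> x0, gradient \<phi> x0, hessian \<phi> x0)) \<in> J2_over X"
      using x0 C2_near_second_order(2)[OF C2] by (simp add: J2_over_def J2_def sym_matrices_def)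
    have "(x0, (\<phi> x0, gradient \<phi> x0, hessian \<phi> x0)) \<in> K"
      unfolding assms(4) in_closure_of
    proof (intro conjI allI impI)
      fix T assume T: "(x0, (\<phi> x0, gradient \<phi> x0, hessian \<phi> x0)) \<in> T \<and> openin (top_of_set (J2_over X)) T"
      then obtain O' where O': "open O'" "T = J2_over X \<inter> O'" by (auto simp: openin_open)
      then have "\<forall>\<^sub>F n in sequentially. j n \<in> O'" using j_lim T by (intro topological_tendstoD) auto
      then obtain n where "j n \<in> O'" using eventually_happens'[OF sequentially_bot] by blast
      moreover have "j n \<in> fiberwise_sum F G" using xp(3) by (simp add: j_def)
      ultimately show "\<exists>y. y \<in> fiberwise_sum F G \<and> y \<in> T" using O' sumJ by blast
    qed (use target in simp)
    then show ?thesis by (simp add: fiber_def)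
  qed
  then show ?thesis using usc unfolding subharmonics_def by auto
qed

end
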